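(* Let $\Gamma$ be a finitely generated, torsion-free, virtually abelian group, let $k$ be a field, let $N$ be a maximal normal abelian subgroup of finite index in $\Gamma$, and let $F=\Gamma/N$. Let $\tilde F$, $\mathcal{Q}$, $\mathcal{Z}$, $\mathcal{L}$ and $H$ be as defined in the context. Then: (i) The ring $\mathcal{Q}$ is Artinian, and moreover $\mathcal{Q}=\mathcal{L}\ast\tilde F$ for a suitable crossed product. In particular, $\tilde F$ is a basis of $\mathcal{Q}$ over $\mathcal{L}$, where $\mathcal{L}$-multiplication is given from the left. Therefore $[\mathcal{Q}:\mathcal{L}]=|F|$. (ii) If $\mathcal{L}^H$ denotes the fixed subfield of $\mathcal{L}$ associated with the subgroup $H\le \mathrm{Aut}(\mathcal{L}/k)$, then $\mathcal{Z}=\mathcal{L}^H$. In particular, $\mathcal{Q}$ is finite-dimensional over $\mathcal{Z}$, and in fact $[\mathcal{Q}:\mathcal{Z}]=|F|^2$.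
   Context: One has $N\cong\mathbb{Z}^n$ for some $n$. $\tilde F\subseteq \Gamma$ is a fixed right transversal of $N$ in $\Gamma$, with the representative of $N$ being $1\in\Gamma$; the image of $\tilde f\in\tilde F$ in $F$ is denoted $f$. The group ring $k[\Gamma]$ is an Ore domain; $\mathcal{Q}$ denotes its Ore field of fractions (a division algebra over $k$), and $\mathcal{Z}$ the center of $\mathcal{Q}$. $\mathcal{L}\subseteq\mathcal{Q}$ is the field of fractions of $k[N]\cong k[x_1^{\pm1},\dots,x_n^{\pm1}]$, identified with $k(x_1,\dots,x_n)$. Each $f\in F$ acts on $\mathcal{L}$ by conjugation, $\alpha_f(p)=\tilde f p\tilde f^{-1}$; this gives an injective group homomorphism $\alpha:F\to\mathrm{Aut}(\mathcal{L}/k)$ whose image is $H$. A crossed product $\mathcal{L}\ast\tilde F$ here is a ring in which each element is uniquely a sum $\sum_{\tilde f\in\tilde F} l_{\tilde f}\tilde f$ with $l_{\tilde f}\in \mathcal{L}$, with componentwise addition and product determined by $(p\tilde f)(q\tilde g)=p\,\sigma_f(q)\,\tau(f,g)\,\widetilde{fg}$ for maps $\sigma:F\to\mathrm{Aut}(\mathcal{L})$ and $\tau:F\times F\to\mathcal{L}^\times$ satisfying $\sigma_1=\mathrm{id}$, $\tau(1,h)=\tau(g,1)=1$, $\tau(g,h)\tau(gh,f)=\sigma_g(\tau(h,f))\tau(g,hf)$ and $\tau(g,h)\sigma_{gh}(r)=\sigma_g(\sigma_h(r))\tau(g,h)$. For a division ring $\mathcal{R}$ and a left $\mathcal{R}$-module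 $V$, $[V:\mathcal{R}]$ denotes the dimension of $V$ over $\mathcal{R}$. *)

theory Defs
  imports "HOL-Algebra.Algebra"
begin

section \<open>Groups\<close>

definition finitely_generated_group :: "('g, 'n) monoid_scheme \<Rightarrow> bool" where
  "finitely_generated_group G \<longleftrightarrow>
     (\<exists>S \<subseteq> carrier G. finite S \<and> generate G S = carrier G)"

definition torsion_free :: "('g, 'n) monoid_scheme \<Rightarrow> bool" where
  "torsion_free G \<longleftrightarrow>
     (\<forall>x \<in> carrier G. \<forall>n::nat. n > 0 \<longrightarrow> x [^]\<^bsub>G\<^esub> n = \<one>\<^bsub>G\<^esub> \<longrightarrow> x = \<one>\<^bsub>G\<^esub>)"

definition abelian_finite_index_subgroup :: "'g set \<Rightarrow> ('g, 'n) monoid_scheme \<Rightarrow> bool" where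
  "abelian_finite_index_subgroup A G \<longleftrightarrow>
     subgroup A G \<and> comm_group (G\<lparr>carrier := A\<rparr>) \<and> finite (rcosets\<^bsub>G\<^esub> A)"

definition virtually_abelian :: "('g, 'n) monoid_scheme \<Rightarrow> bool" where
  "virtually_abelian G \<longleftrightarrow> (\<exists>A. abelian_finite_index_subgroup A G)"

definition maximal_normal_abelian_finite_index :: "'g set \<Rightarrow> ('g, 'n) monoid_scheme \<Rightarrow> bool" where
  "maximal_normal_abelian_finite_index N G \<longleftrightarrow>
     N \<lhd> G \<and> abelian_finite_index_subgroup N G \<and>
     (\<forall>M. M \<lhd> G \<longrightarrow> abelian_finite_index_subgroup M G \<longrightarrow> N \<subseteq> M \<longrightarrow> M = N)"

definition right_transversal :: "'g set \<Rightarrow> 'g set \<Rightarrow> ('g, 'n) monoid_scheme \<Rightarrow> bool" where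
  "right_transversal T N G \<longleftrightarrow>
     T \<subseteq> carrier G \<and> (\<forall>C \<in> rcosets\<^bsub>G\<^esub> N. \<exists>!t. t \<in> T \<and> t \<in> C)"

text \<open>The element of the transversal \<open>T\<close> that represents the coset \<open>C\<close>.\<close>

definition coset_rep :: "'g set \<Rightarrow> 'g set \<Rightarrow> 'g" where
  "coset_rep T C = (THE t. t \<in> T \<and> t \<in> C)"

section \<open>Group rings\<close>

text \<open>Elements are finitely supported functions on the group, extended by zero outside
  the carrier; multiplication is convolution.\<close>

definition group_ring ::
  "('k, 'm) ring_scheme \<Rightarrow> ('g, 'n) monoid_scheme \<Rightarrow> ('g \<Rightarrow> 'k) ring" where
  "group_ring K G =
     \<lparr>carrier = {a. (\<forall>g \<in> carrier G. a g \<in> carrier K) \<and>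
                    (\<forall>g. g \<notin> carrier G \<longrightarrow> a g = \<zero>\<^bsub>K\<^esub>) \<and>
                    finite {g. a g \<noteq> \<zero>\<^bsub>K\<^esub>}},
      monoid.mult = (\<lambda>a b g. if g \<in> carrier G
                then (\<Oplus>\<^bsub>K\<^esub>h \<in> {h \<in> carrier G. a h \<noteq> \<zero>\<^bsub>K\<^esub>}. a h \<otimes>\<^bsub>K\<^esub> b (inv\<^bsub>G\<^esub> h \<otimes>\<^bsub>G\<^esub> g))
                else \<zero>\<^bsub>K\<^esub>),
      one = (\<lambda>g. if g = \<one>\<^bsub>G\<^esub> then \<one>\<^bsub>K\<^esub> else \<zero>\<^bsub>K\<^esub>),
      ring.zero = (\<lambda>g. \<zero>\<^bsub>K\<^esub>),
      ring.add = (\<lambda>a b g. a g \<oplus>\<^bsub>K\<^esub> b g)\<rparr>"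

definition group_ring_elt :: "('k, 'm) ring_scheme \<Rightarrow> 'g \<Rightarrow> 'g \<Rightarrow> 'k" where
  "group_ring_elt K x = (\<lambda>g. if g = x then \<one>\<^bsub>K\<^esub> else \<zero>\<^bsub>K\<^esub>)"

text \<open>The group ring of the subgroup \<open>N\<close>, as a subset of the group ring of \<open>G\<close>.\<close>

definition sub_group_ring ::
  "('k, 'm) ring_scheme \<Rightarrow> ('g, 'n) monoid_scheme \<Rightarrow> 'g set \<Rightarrow> ('g \<Rightarrow> 'k) set" where
  "sub_group_ring K G N =
     {a \<in> carrier (group_ring K G). \<forall>g. g \<notin> N \<longrightarrow> a g = \<zero>\<^bsub>K\<^esub>}"

section \<open>Noncommutative rings\<close>

definition division_ring :: "('a, 'm) ring_scheme \<Rightarrow> bool" where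
  "division_ring R \<longleftrightarrow>
     ring R \<and> \<one>\<^bsub>R\<^esub> \<noteq> \<zero>\<^bsub>R\<^esub> \<and> Units R = carrier R - {\<zero>\<^bsub>R\<^esub>}"

definition ring_center :: "('a, 'm) ring_scheme \<Rightarrow> 'a set" where
  "ring_center R = {z \<in> carrier R. \<forall>x \<in> carrier R. z \<otimes>\<^bsub>R\<^esub> x = x \<otimes>\<^bsub>R\<^esub> z}"

definition left_ideal :: "'a set \<Rightarrow> ('a, 'm) ring_scheme \<Rightarrow> bool" where
  "left_ideal I R \<longleftrightarrow>
     additive_subgroup I R \<and> (\<forall>a \<in> I. \<forall>x \<in> carrier R. x \<otimes>\<^bsub>R\<^esub> a \<in> I)"

definition right_ideal :: "'a set \<Rightarrow> ('a, 'm) ring_scheme \<Rightarrow> bool" where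
  "right_ideal I R \<longleftrightarrow>
     additive_subgroup I R \<and> (\<forall>a \<in> I. \<forall>x \<in> carrier R. a \<otimes>\<^bsub>R\<^esub> x \<in> I)"

definition artinian_ring :: "('a, 'm) ring_scheme \<Rightarrow> bool" where
  "artinian_ring R \<longleftrightarrow> ring R \<and>
     (\<forall>I :: nat \<Rightarrow> 'a set. (\<forall>n. left_ideal (I n) R) \<longrightarrow> (\<forall>n. I (Suc n) \<subseteq> I n) \<longrightarrow>
        (\<exists>m. \<forall>n \<ge> m. I n = I m)) \<and>
     (\<forall>I :: nat \<Rightarrow> 'a set. (\<forall>n. right_ideal (I n) R) \<longrightarrow> (\<forall>n. I (Suc n) \<subseteq> I n) \<longrightarrow>
        (\<exists>m. \<forall>n \<ge> m. I n = I m))"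

text \<open>\<open>Q\<close>, with the embedding \<open>\<iota>\<close>, is the field of fractions of the (two-sided) Ore
  domain \<open>R\<close>.  It is determined by \<open>R\<close> up to unique isomorphism, and its existence is
  equivalent to \<open>R\<close> being an Ore domain.\<close>

definition ore_field_of_fractions ::
  "('a, 'm) ring_scheme \<Rightarrow> ('q, 'n) ring_scheme \<Rightarrow> ('a \<Rightarrow> 'q) \<Rightarrow> bool" where
  "ore_field_of_fractions R Q \<iota> \<longleftrightarrow>
     division_ring Q \<and> \<iota> \<in> ring_hom R Q \<and> inj_on \<iota> (carrier R) \<and>
     (\<forall>x \<in> carrier Q. \<exists>a \<in> carrier R. \<exists>b \<in> carrier R - {\<zero>\<^bsub>R\<^esub>}.
        x = \<iota> a \<otimes>\<^bsub>Q\<^esub> inv\<^bsub>Q\<^esub> (\<iota> b)) \<and>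
     (\<forall>x \<in> carrier Q. \<exists>a \<in> carrier R. \<exists>b \<in> carrier R - {\<zero>\<^bsub>R\<^esub>}.
        x = inv\<^bsub>Q\<^esub> (\<iota> b) \<otimes>\<^bsub>Q\<^esub> \<iota> a)"

text \<open>\<open>B\<close> is a basis of \<open>R\<close> as a left vector space over its subfield \<open>L\<close>.  The notions
  \<open>Span\<close>, \<open>independent\<close> and \<open>dimension\<close> of \<open>HOL-Algebra.Embedded_Algebras\<close> have
  scalars acting from the left, and do not require \<open>R\<close> to be commutative.\<close>

definition left_basis :: "('a, 'm) ring_scheme \<Rightarrow> 'a set \<Rightarrow> 'a set \<Rightarrow> bool" where
  "left_basis R L B \<longleftrightarrow>
     (\<exists>bs. set bs = B \<and> ring.independent R L bs \<and> ring.Span R L bs = carrier R)"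

section \<open>Crossed products\<close>

text \<open>\<open>R\<close> is the crossed product of the field \<open>L\<close> (a subfield of \<open>R\<close>) and the finite
  group \<open>F\<close>, where \<open>u f\<close> is the element of \<open>R\<close> written as \<open>f\<close> with a tilde.\<close>

definition crossed_product ::
  "('q, 'm) ring_scheme \<Rightarrow> 'q set \<Rightarrow> ('f, 'n) monoid_scheme \<Rightarrow> ('f \<Rightarrow> 'q) \<Rightarrow>
   ('f \<Rightarrow> 'q \<Rightarrow> 'q) \<Rightarrow> ('f \<Rightarrow> 'f \<Rightarrow> 'q) \<Rightarrow> bool" where
  "crossed_product R L F u \<sigma> \<tau> \<longleftrightarrow>
     ring R \<and> subfield L R \<and> group F \<and> finite (carrier F) \<and>
     u \<in> carrier F \<rightarrow> carrier R \<and>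
     (\<forall>f \<in> carrier F. \<sigma> f \<in> ring_iso (R\<lparr>carrier := L\<rparr>) (R\<lparr>carrier := L\<rparr>)) \<and>
     (\<forall>f \<in> carrier F. \<forall>g \<in> carrier F. \<tau> f g \<in> L - {\<zero>\<^bsub>R\<^esub>}) \<and>
     (\<forall>p \<in> L. \<sigma> \<one>\<^bsub>F\<^esub> p = p) \<and>
     (\<forall>f \<in> carrier F. \<tau> \<one>\<^bsub>F\<^esub> f = \<one>\<^bsub>R\<^esub> \<and> \<tau> f \<one>\<^bsub>F\<^esub> = \<one>\<^bsub>R\<^esub>) \<and>
     (\<forall>g \<in> carrier F. \<forall>h \<in> carrier F. \<forall>f \<in> carrier F.
        \<tau> g h \<otimes>\<^bsub>R\<^esub> \<tau> (g \<otimes>\<^bsub>F\<^esub> h) f = \<sigma> g (\<tau> h f) \<otimes>\<^bsub>R\<^esub> \<tau> g (h \<otimes>\<^bsub>F\<^esub> f)) \<and>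
     (\<forall>g \<in> carrier F. \<forall>h \<in> carrier F. \<forall>r \<in> L.
        \<tau> g h \<otimes>\<^bsub>R\<^esub> \<sigma> (g \<otimes>\<^bsub>F\<^esub> h) r = \<sigma> g (\<sigma> h r) \<otimes>\<^bsub>R\<^esub> \<tau> g h) \<and>
     (\<forall>x \<in> carrier R. \<exists>!l. l \<in> carrier F \<rightarrow>\<^sub>E L \<and>
        x = (\<Oplus>\<^bsub>R\<^esub>f \<in> carrier F. l f \<otimes>\<^bsub>R\<^esub> u f)) \<and>
     (\<forall>l \<in> carrier F \<rightarrow> L. \<forall>m \<in> carrier F \<rightarrow> L.
        (\<Oplus>\<^bsub>R\<^esub>f \<in> carrier F. l f \<otimes>\<^bsub>R\<^esub> u f) \<oplus>\<^bsub>R\<^esub> (\<Oplus>\<^bsub>R\<^esub>f \<in> carrier F. m f \<otimes>\<^bsub>R\<^esub> u f) =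
        (\<Oplus>\<^bsub>R\<^esub>f \<in> carrier F. (l f \<oplus>\<^bsub>R\<^esub> m f) \<otimes>\<^bsub>R\<^esub> u f)) \<and>
     (\<forall>f \<in> carrier F. \<forall>g \<in> carrier F. \<forall>p \<in> L. \<forall>q \<in> L.
        (p \<otimes>\<^bsub>R\<^esub> u f) \<otimes>\<^bsub>R\<^esub> (q \<otimes>\<^bsub>R\<^esub> u g) =
        (p \<otimes>\<^bsub>R\<^esub> \<sigma> f q \<otimes>\<^bsub>R\<^esub> \<tau> f g) \<otimes>\<^bsub>R\<^esub> u (f \<otimes>\<^bsub>F\<^esub> g))"

section \<open>The objects attached to the Ore field of fractions of a group ring\<close>

text \<open>The field of fractions, inside \<open>Q\<close>, of the group ring of \<open>N\<close>.\<close>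

definition frac_sub ::
  "('k, 'm) ring_scheme \<Rightarrow> ('g, 'n) monoid_scheme \<Rightarrow> 'g set \<Rightarrow>
   ('q, 'r) ring_scheme \<Rightarrow> (('g \<Rightarrow> 'k) \<Rightarrow> 'q) \<Rightarrow> 'q set" where
  "frac_sub K G N Q \<iota> =
     {\<iota> a \<otimes>\<^bsub>Q\<^esub> inv\<^bsub>Q\<^esub> (\<iota> b) | a b.
        a \<in> sub_group_ring K G N \<and> b \<in> sub_group_ring K G N - {\<zero>\<^bsub>group_ring K G\<^esub>}}"

text \<open>The image in \<open>Q\<close> of the representative of a coset.\<close>

definition lift_elt ::
  "('k, 'm) ring_scheme \<Rightarrow> (('g \<Rightarrow> 'k) \<Rightarrow> 'q) \<Rightarrow> 'g set \<Rightarrow> 'g set \<Rightarrow> 'q" where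
  "lift_elt K \<iota> T C = \<iota> (group_ring_elt K (coset_rep T C))"

definition conj_on :: "('q, 'r) ring_scheme \<Rightarrow> 'q set \<Rightarrow> 'q \<Rightarrow> 'q \<Rightarrow> 'q" where
  "conj_on Q L u = (\<lambda>p \<in> L. u \<otimes>\<^bsub>Q\<^esub> p \<otimes>\<^bsub>Q\<^esub> inv\<^bsub>Q\<^esub> u)"

text \<open>The image \<open>H\<close> of \<open>\<alpha>\<close>.  Its members are maps on \<open>L = frac_sub K G N Q \<iota>\<close>, made
  \<open>undefined\<close> outside \<open>L\<close>.\<close>

definition conj_group ::
  "('k, 'm) ring_scheme \<Rightarrow> ('g, 'n) monoid_scheme \<Rightarrow> 'g set \<Rightarrow> 'g set \<Rightarrow>
   ('q, 'r) ring_scheme \<Rightarrow> (('g \<Rightarrow> 'k) \<Rightarrow> 'q) \<Rightarrow> ('q \<Rightarrow> 'q) set" where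
  "conj_group K G N T Q \<iota> =
     (\<lambda>f. conj_on Q (frac_sub K G N Q \<iota>) (lift_elt K \<iota> T f)) ` carrier (G Mod N)"

definition fixed_subfield :: "'q set \<Rightarrow> ('q \<Rightarrow> 'q) set \<Rightarrow> 'q set" where
  "fixed_subfield L H = {p \<in> L. \<forall>\<phi> \<in> H. \<phi> p = p}"

end

theory Submission
  imports Defs
begin

text \<open>
  Everything rests on one fact about the group: the elements of \<open>\<Gamma>\<close> that commute with \<open>N\<close> lie in
  \<open>N\<close>, so that distinct elements of \<open>F\<close> act by distinct automorphisms on \<open>N\<close>, hence on \<open>L\<close>. The
  centralizer \<open>C\<close> of \<open>N\<close> has the central subgroup \<open>N\<close> of finite index. The transfer is a homomorphism
  from \<open>C\<close> to the abelian group \<open>N\<close>; its kernel is torsion, because on \<open>N\<close> it is a power map, so it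
  is trivial and \<open>C\<close> is abelian. As \<open>C\<close> is also normal, maximality gives \<open>C = N\<close>
  (\<open>centralizer_of_maximal_normal_abelian\<close>).

  The rest takes place in a division ring \<open>R\<close> with a subfield \<open>L\<close> and units \<open>u f\<close>, indexed by a
  finite group, that normalize \<open>L\<close>, multiply up to factors in \<open>L\<close>, and induce pairwise distinct
  automorphisms of \<open>L\<close>. The engine is Dedekind's elimination argument in the form
  \<open>term_in_sub_bimodule\<close>: the lines \<open>L u f\<close> are pairwise non-isomorphic \<open>L\<close>-bimodules, so a
  sub-bimodule that contains a sum of elements of them contains each summand. It is used twice.

  For the zero bimodule it says that the \<open>u f\<close> are linearly independent over \<open>L\<close>. Their span is closed
  under products, and since it has finite dimension, right multiplication by a nonzero element of it is
  onto; thus the span is closed under inverses. It contains the group ring, so it is all of \<open>Q\<close>.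
  This gives the basis, the crossed product and \<open>[Q : L] = |F|\<close>, and comparing coefficients
  determines the center (\<open>center_eq_fixed\<close>).

  For the bimodule generated by \<open>s = \<Sum>f. u f\<close> it says that \<open>L s L = Q\<close>. Therefore \<open>Q\<close> has a left
  \<open>L\<close>-basis \<open>s a\<^sub>1, \<dots>, s a\<^sub>n\<close> with \<open>a\<^sub>i \<in> L\<close> and \<open>n = |F|\<close>. Because \<open>s a = \<Sum>f. f(a) u f\<close>, the
  coordinates of \<open>s a\<close>, for \<open>a \<in> L\<close>, in this basis are the solution of a linear system that the group only permutes, so
  they are fixed by it, and the \<open>a\<^sub>i\<close> form a basis of \<open>L\<close> over the fixed field
  (\<open>dimension_over_fixed\<close>). This is Artin's theorem \<open>[L : Z] = |F|\<close>; multiplicativity of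
  dimensions gives \<open>[Q : Z] = |F|\<^sup>2\<close>.
\<close>

section \<open>Transfer, and centralizers in torsion-free groups\<close>

text \<open>
  The transfer to a central subgroup. Write \<open>r Y\<close> for a representative of the coset \<open>Y\<close>; then
  \<open>r Y \<otimes> g\<close> and \<open>r (Y #> g)\<close> lie in the same coset and differ by a factor \<open>z Y g \<in> N\<close>. The \<open>z\<close>
  satisfy a cocycle identity, so their product over all cosets is multiplicative in \<open>g\<close>, since
  translation by \<open>g\<close> permutes the cosets. A central \<open>n\<close> fixes every coset, and \<open>z Y n = n\<close>.
\<close>

lemma (in group) transfer_hom_exists:
  assumes N: "subgroup N G" and fin: "finite (rcosets N)"
    and central: "\<And>n g. n \<in> N \<Longrightarrow> g \<in> carrier G \<Longrightarrow> n \<otimes> g = g \<otimes> n"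
  obtains V where "V \<in> hom G (G\<lparr>carrier := N\<rparr>)"
    and "\<And>n. n \<in> N \<Longrightarrow> V n = n [^] card (rcosets N)"
proof -
  interpret N: subgroup N G by fact
  have sub: "N \<subseteq> carrier G" by (rule N.subset)
  interpret NG: comm_group "G\<lparr>carrier := N\<rparr>"
    by (rule group.group_comm_groupI[OF subgroup.subgroup_is_group[OF N is_group]])
       (use central sub in auto)
  define r where "r Y = (SOME x. x \<in> Y)" for Y :: "'a set"
  define z where "z = (\<lambda>Y g. r Y \<otimes> g \<otimes> inv r (Y #> g))"
  define V where "V = (\<lambda>g. finprod (G\<lparr>carrier := N\<rparr>) (\<lambda>Y. z Y g) (rcosets N))"
  have r_in: "r Y \<in> Y" if "Y \<in> rcosets N" for Y
    unfolding r_def using N.rcosets_non_empty[OF that] by (simp add: some_in_eq)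
  have X_sub: "Y \<subseteq> carrier G" if "Y \<in> rcosets N" for Y
    using N.rcosets_carrier[OF is_group that] .
  have r_carrier: "r Y \<in> carrier G" if "Y \<in> rcosets N" for Y
    using r_in[OF that] X_sub[OF that] by blast
  have shift: "Y #> g \<in> rcosets N" if Y: "Y \<in> rcosets N" and g: "g \<in> carrier G" for Y g
  proof -
    obtain x where "x \<in> carrier G" "Y = N #> x" using Y unfolding RCOSETS_def by blast
    then show ?thesis using g coset_mult_assoc[OF sub] rcosetsI[OF sub] by simp
  qed
  have shift_shift: "Y #> g #> h = Y #> (g \<otimes> h)"
    if "Y \<in> rcosets N" "g \<in> carrier G" "h \<in> carrier G" for Y g h
    using coset_mult_assoc[OF X_sub] that by simp
  have z_in: "z Y g \<in> N" if Y: "Y \<in> rcosets N" and g: "g \<in> carrier G" for Y g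
  proof -
    have "r Y \<otimes> g \<in> Y #> g" using r_in[OF Y] unfolding r_coset_def by blast
    then show ?thesis unfolding z_def
      using diff_neutralizes[OF N shift[OF Y g]] r_in[OF shift[OF Y g]] by blast
  qed
  have z_mult: "z Y (g \<otimes> h) = z Y g \<otimes> z (Y #> g) h"
    if Y: "Y \<in> rcosets N" and g: "g \<in> carrier G" and h: "h \<in> carrier G" for Y g h
  proof -
    have "inv r (Y #> g) \<otimes> (r (Y #> g) \<otimes> (h \<otimes> inv r (Y #> g #> h))) = h \<otimes> inv r (Y #> g #> h)"
      using r_carrier shift Y g h by (simp add: m_assoc[symmetric])
    then show ?thesis unfolding z_def using Y g h r_carrier shift
      by (simp add: m_assoc shift_shift)
  qed
  have V_closed: "V g \<in> N" if "g \<in> carrier G" for g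
    unfolding V_def using NG.finprod_closed[of "\<lambda>Y. z Y g" "rcosets N"] z_in that by auto
  have V_mult: "V (g \<otimes> h) = V g \<otimes> V h" if g: "g \<in> carrier G" and h: "h \<in> carrier G" for g h
  proof -
    have inj: "inj_on (\<lambda>Y. Y #> g) (rcosets N)"
      by (rule inj_on_inverseI[of _ "\<lambda>Y. Y #> inv g"])
         (use g in \<open>simp add: shift_shift coset_mult_one[OF X_sub]\<close>)
    have "(\<lambda>Y. Y #> g) ` (rcosets N) \<subseteq> rcosets N" using shift g by blast
    then have img: "(\<lambda>Y. Y #> g) ` (rcosets N) = rcosets N"
      using endo_inj_surj[OF fin _ inj] by blast
    have "V (g \<otimes> h) = finprod (G\<lparr>carrier := N\<rparr>) (\<lambda>Y. z Y g \<otimes> z (Y #> g) h) (rcosets N)"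
      unfolding V_def by (rule NG.finprod_cong') (use z_mult z_in shift g h in auto)
    also have "\<dots> = V g \<otimes> finprod (G\<lparr>carrier := N\<rparr>) (\<lambda>Y. z (Y #> g) h) (rcosets N)"
      unfolding V_def
      using NG.finprod_multf[of "\<lambda>Y. z Y g" "rcosets N" "\<lambda>Y. z (Y #> g) h"] z_in shift g h by auto
    also have "finprod (G\<lparr>carrier := N\<rparr>) (\<lambda>Y. z (Y #> g) h) (rcosets N) = V h"
      unfolding V_def
      using NG.finprod_reindex[of "\<lambda>Y. z Y h" "\<lambda>Y. Y #> g" "rcosets N"] img inj z_in h by auto
    finally show ?thesis .
  qed
  have "V n = n [^] card (rcosets N)" if n: "n \<in> N" for n
  proof -
    have nG: "n \<in> carrier G" using n sub by blast
    have "z Y n = n" if Y: "Y \<in> rcosets N" for Y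
    proof -
      obtain x where x: "x \<in> carrier G" "Y = N #> x" using Y unfolding RCOSETS_def by blast
      have "Y #> n = N #> (n \<otimes> x)" using x nG central[OF n x(1)] coset_mult_assoc[OF sub] by simp
      also have "\<dots> = Y" using x nG coset_mult_assoc[OF sub nG x(1)] N.rcos_const[OF is_group n] by simp
      finally show ?thesis unfolding z_def
        using central[OF n r_carrier[OF Y]] r_carrier[OF Y] nG by (metis inv_solve_right' m_closed)
    qed
    then have "V n = finprod (G\<lparr>carrier := N\<rparr>) (\<lambda>Y. n) (rcosets N)"
      unfolding V_def by (intro NG.finprod_cong') (use n in auto)
    also have "\<dots> = n [^]\<^bsub>G\<lparr>carrier := N\<rparr>\<^esub> card (rcosets N)" using NG.finprod_const n by simp
    finally show ?thesis by (simp add: nat_pow_consistent[symmetric])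
  qed
  moreover have "V \<in> hom G (G\<lparr>carrier := N\<rparr>)"
    by (rule homI) (use V_closed V_mult in auto)
  ultimately show thesis using that by blast
qed

text \<open>
  A homomorphism to an abelian group kills every commutator \<open>c\<close>. If \<open>m\<close> is the index of \<open>N\<close>, then
  \<open>c [^] m\<close> lies in \<open>N\<close>, where the transfer is the \<open>m\<close>-th power map; hence \<open>c [^] (m * m) = \<one>\<close>.
\<close>

lemma (in group) torsion_free_central_finite_index_comm:
  assumes N: "subgroup N G" and fin: "finite (rcosets N)"
    and central: "\<And>n g. n \<in> N \<Longrightarrow> g \<in> carrier G \<Longrightarrow> n \<otimes> g = g \<otimes> n"
    and tf: "torsion_free G"
    and g: "g \<in> carrier G" and h: "h \<in> carrier G"
  shows "g \<otimes> h = h \<otimes> g"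
proof -
  interpret N: subgroup N G by fact
  have sub: "N \<subseteq> carrier G" by (rule N.subset)
  interpret NG: comm_group "G\<lparr>carrier := N\<rparr>"
    by (rule group.group_comm_groupI[OF subgroup.subgroup_is_group[OF N is_group]])
       (use central sub in auto)
  have normal: "N \<lhd> G"
  proof (rule normal_invI[OF N])
    fix x n assume "x \<in> carrier G" "n \<in> N"
    then show "x \<otimes> n \<otimes> inv x \<in> N"
      using central[of n x] sub by (metis inv_solve_right' m_closed subsetD)
  qed
  then interpret Nn: normal N G .
  obtain V where V: "V \<in> hom G (G\<lparr>carrier := N\<rparr>)"
    and Vn: "\<And>n. n \<in> N \<Longrightarrow> V n = n [^] card (rcosets N)"
    using transfer_hom_exists[OF N fin central] by blast
  interpret V: group_hom G "G\<lparr>carrier := N\<rparr>" V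
    using V NG.is_group by (simp add: group_hom_def group_hom_axioms_def is_group)
  define c where "c = g \<otimes> h \<otimes> inv (h \<otimes> g)"
  have c: "c \<in> carrier G" and ch: "g \<otimes> h = c \<otimes> (h \<otimes> g)"
    unfolding c_def using g h by (simp_all add: m_assoc)
  have "V c \<otimes> (V h \<otimes> V g) = V g \<otimes> V h"
    using V.hom_mult[of c "h \<otimes> g"] V.hom_mult[of g h] V.hom_mult[of h g] g h c ch by simp
  then have "V c \<otimes> (V g \<otimes> V h) = V g \<otimes> V h"
    using NG.m_comm[of "V g" "V h"] V.hom_closed g h by simp
  then have Vc: "V c = \<one>"
    using NG.r_cancel_one[of "V g \<otimes> V h" "V c"] V.hom_closed g h c by simp
  define m where "m = card (rcosets N)"
  have m0: "m > 0" unfolding m_def using fin N.subgroup_in_rcosets[OF is_group] card_gt_0_iff by blast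
  have "(N #> c) [^]\<^bsub>G Mod N\<^esub> order (G Mod N) = \<one>\<^bsub>G Mod N\<^esub>"
    by (rule group.pow_order_eq_1[OF Nn.factorgroup_is_group])
       (use c in \<open>auto simp: carrier_FactGroup\<close>)
  then have "N #> (c [^] m) = N"
    using Nn.FactGroup_pow[OF c] by (simp add: m_def order_def FactGroup_def)
  then have cm: "c [^] m \<in> N" using rcos_self[of "c [^] m" N] c N by simp
  have "(c [^] m) [^] m = V (c [^] m)" using Vn[OF cm] by (simp add: m_def)
  also have "\<dots> = \<one>" using V.hom_nat_pow[OF c, of m] Vc by (simp add: nat_pow_consistent[symmetric])
  finally have "c [^] (m * m) = \<one>" using c by (simp add: nat_pow_pow)
  then have "c = \<one>" using tf c m0 unfolding torsion_free_def by (metis nat_0_less_mult_iff)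
  then show ?thesis using ch g h by simp
qed

text \<open>
  The whole centralizer of \<open>N\<close> is an abelian normal subgroup of finite index, so by maximality it is
  no larger than \<open>N\<close>. Passing to the whole centralizer, and not only adjoining \<open>c\<close> to \<open>N\<close>, is what
  makes the subgroup normal.
\<close>

lemma (in group) centralizer_of_maximal_normal_abelian:
  assumes tf: "torsion_free G" and max: "maximal_normal_abelian_finite_index N G"
    and c: "c \<in> carrier G" and comm: "\<And>n. n \<in> N \<Longrightarrow> c \<otimes> n = n \<otimes> c"
  shows "c \<in> N"
proof -
  have normal: "N \<lhd> G" and N: "subgroup N G" and Ncomm: "comm_group (G\<lparr>carrier := N\<rparr>)"
    and fin: "finite (rcosets N)"
    and maximal: "\<And>M. M \<lhd> G \<Longrightarrow> abelian_finite_index_subgroup M G \<Longrightarrow> N \<subseteq> M \<Longrightarrow> M = N"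
    using max unfolding maximal_normal_abelian_finite_index_def abelian_finite_index_subgroup_def
    by blast+
  interpret N: normal N G by fact
  have sub: "N \<subseteq> carrier G" by (rule N.subset)
  define C where "C = {x \<in> carrier G. \<forall>n\<in>N. x \<otimes> n = n \<otimes> x}"
  have C: "subgroup C G"
  proof (rule subgroupI)
    show "C \<subseteq> carrier G" "C \<noteq> {}" unfolding C_def using sub by auto
    fix x assume x: "x \<in> C"
    show "inv x \<in> C" unfolding C_def
    proof (intro CollectI conjI ballI)
      show "inv x \<in> carrier G" using x unfolding C_def by simp
      fix n assume n: "n \<in> N"
      have "x \<otimes> n = n \<otimes> x" "x \<in> carrier G" "n \<in> carrier G" using x n sub unfolding C_def by auto
      then show "inv x \<otimes> n = n \<otimes> inv x"
        by (metis inv_closed inv_solve_left inv_solve_right m_assoc m_closed)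
    qed
    fix y assume y: "y \<in> C"
    show "x \<otimes> y \<in> C" unfolding C_def
    proof (intro CollectI conjI ballI)
      show "x \<otimes> y \<in> carrier G" using x y unfolding C_def by simp
      fix n assume n: "n \<in> N"
      have "x \<otimes> n = n \<otimes> x" "y \<otimes> n = n \<otimes> y" "x \<in> carrier G" "y \<in> carrier G" "n \<in> carrier G"
        using x y n sub unfolding C_def by auto
      then show "x \<otimes> y \<otimes> n = n \<otimes> (x \<otimes> y)" by (metis m_assoc)
    qed
  qed
  interpret C: subgroup C G by fact
  have NC: "N \<subseteq> C" unfolding C_def using sub Ncomm comm_groupE(4)[OF Ncomm] by auto
  have C_normal: "C \<lhd> G"
  proof (rule normal_invI[OF C])
    fix g x assume g: "g \<in> carrier G" and x: "x \<in> C"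
    then have xG: "x \<in> carrier G" by simp
    show "g \<otimes> x \<otimes> inv g \<in> C" unfolding C_def
    proof (intro CollectI conjI ballI)
      show "g \<otimes> x \<otimes> inv g \<in> carrier G" using g xG by simp
      fix n assume n: "n \<in> N"
      then have nG: "n \<in> carrier G" using sub by blast
      have "inv g \<otimes> n \<otimes> g \<in> N" using N.inv_op_closed1 g n by blast
      then have 1: "x \<otimes> (inv g \<otimes> n \<otimes> g) = (inv g \<otimes> n \<otimes> g) \<otimes> x" using x unfolding C_def by blast
      have "g \<otimes> x \<otimes> inv g \<otimes> n = g \<otimes> (x \<otimes> (inv g \<otimes> n \<otimes> g)) \<otimes> inv g"
        using g xG nG by (simp add: m_assoc)
      also have "\<dots> = n \<otimes> (g \<otimes> x \<otimes> inv g)"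
        unfolding 1 using g xG nG by (simp add: m_assoc[symmetric])
      finally show "g \<otimes> x \<otimes> inv g \<otimes> n = n \<otimes> (g \<otimes> x \<otimes> inv g)" .
    qed
  qed
  have Cgrp: "group (G\<lparr>carrier := C\<rparr>)" using C.subgroup_is_group is_group by blast
  have C_comm: "x \<otimes> y = y \<otimes> x" if "x \<in> C" "y \<in> C" for x y
  proof -
    have "rcosets\<^bsub>G\<lparr>carrier := C\<rparr>\<^esub> N \<subseteq> rcosets N" unfolding RCOSETS_def using C.subset by auto
    then have f: "finite (rcosets\<^bsub>G\<lparr>carrier := C\<rparr>\<^esub> N)" using fin finite_subset by blast
    have s: "subgroup N (G\<lparr>carrier := C\<rparr>)" using subgroup_incl[OF N C NC] .
    have t: "torsion_free (G\<lparr>carrier := C\<rparr>)"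
      unfolding torsion_free_def nat_pow_consistent[symmetric]
    proof (intro ballI allI impI)
      fix x and n :: nat
      assume "x \<in> carrier (G\<lparr>carrier := C\<rparr>)" and n: "n > 0" and "x [^] n = \<one>\<^bsub>G\<lparr>carrier := C\<rparr>\<^esub>"
      then have "x \<in> carrier G" and "x [^] n = \<one>" using C.subset by auto
      then have "x = \<one>" using tf n unfolding torsion_free_def by blast
      then show "x = \<one>\<^bsub>G\<lparr>carrier := C\<rparr>\<^esub>" by simp
    qed
    have z: "n \<otimes>\<^bsub>G\<lparr>carrier := C\<rparr>\<^esub> g = g \<otimes>\<^bsub>G\<lparr>carrier := C\<rparr>\<^esub> n"
      if "n \<in> N" "g \<in> carrier (G\<lparr>carrier := C\<rparr>)" for n g
      using that unfolding C_def by simp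
    have "x \<otimes>\<^bsub>G\<lparr>carrier := C\<rparr>\<^esub> y = y \<otimes>\<^bsub>G\<lparr>carrier := C\<rparr>\<^esub> x"
      by (rule group.torsion_free_central_finite_index_comm[OF Cgrp s f z t]) (use that in simp_all)
    then show ?thesis by simp
  qed
  have "rcosets C \<subseteq> (\<lambda>Y. C <#> Y) ` (rcosets N)"
  proof
    fix Y assume "Y \<in> rcosets C"
    then obtain g where g: "g \<in> carrier G" "Y = C #> g" unfolding RCOSETS_def by blast
    have "C <#> N = C"
    proof
      show "C <#> N \<subseteq> C" unfolding set_mult_def using NC by auto
      show "C \<subseteq> C <#> N"
      proof
        fix x assume "x \<in> C"
        then show "x \<in> C <#> N"
          unfolding set_mult_def using N.one_closed r_one[of x] C.subset by blast
      qed
    qed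
    then have "C <#> (N #> g) = Y" using setmult_rcos_assoc[OF C.subset sub g(1)] g(2) by simp
    then show "Y \<in> (\<lambda>Y. C <#> Y) ` (rcosets N)" using rcosetsI[OF sub g(1)] by blast
  qed
  then have "finite (rcosets C)" using fin finite_surj by blast
  moreover have "comm_group (G\<lparr>carrier := C\<rparr>)"
    by (rule group.group_comm_groupI[OF Cgrp]) (use C_comm in auto)
  ultimately have "C = N"
    using maximal[OF C_normal _ NC] C unfolding abelian_finite_index_subgroup_def by blast
  moreover have "c \<in> C" unfolding C_def using c comm by blast
  ultimately show ?thesis by blast
qed

section \<open>Division rings and their subfields\<close>

lemma (in ring) subfield_of_division_ringI:
  assumes division: "Units R = carrier R - {\<zero>}" and "\<one> \<noteq> \<zero>" and sub: "subring K R"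
    and comm: "\<And>x y. x \<in> K \<Longrightarrow> y \<in> K \<Longrightarrow> x \<otimes> y = y \<otimes> x"
    and inv: "\<And>x. x \<in> K - {\<zero>} \<Longrightarrow> inv x \<in> K"
  shows "subfield K R"
proof (rule subfieldI)
  show "subcring K R" using sub comm by (rule subcringI)
  show "Units (R\<lparr>carrier := K\<rparr>) = K - {\<zero>}"
  proof (intro equalityI subsetI)
    fix x assume "x \<in> Units (R\<lparr>carrier := K\<rparr>)"
    then obtain y where "x \<in> K" "y \<in> K" "x \<otimes> y = \<one>" unfolding Units_def by auto
    then show "x \<in> K - {\<zero>}" using \<open>\<one> \<noteq> \<zero>\<close> subringE(1)[OF sub] by auto
  next
    fix x assume x: "x \<in> K - {\<zero>}"
    then have "x \<in> Units R" using subringE(1)[OF sub] division by auto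
    then have "x \<otimes> inv x = \<one>" "inv x \<otimes> x = \<one>" by simp_all
    then show "x \<in> Units (R\<lparr>carrier := K\<rparr>)"
      unfolding Units_def using inv[OF x] x by auto
  qed
qed

lemma (in ring) inv_commute:
  assumes "a \<in> carrier R" "b \<in> Units R" "a \<otimes> b = b \<otimes> a"
  shows "a \<otimes> inv b = inv b \<otimes> a"
proof -
  have "inv b \<otimes> a = inv b \<otimes> (a \<otimes> b) \<otimes> inv b" using assms(1,2) by (simp add: m_assoc Units_closed)
  also have "\<dots> = a \<otimes> inv b" unfolding assms(3) using assms(1,2) by (simp add: m_assoc[symmetric] Units_closed)
  finally show ?thesis by simp
qed

text \<open>
  Elements of the commutative subring commute with inverses of such elements, so fractions are added
  and multiplied by the usual formulas of commutative algebra.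
\<close>

lemma (in ring) fractions_subfield:
  assumes division: "Units R = carrier R - {\<zero>}" and one: "\<one> \<noteq> \<zero>" and sub: "subring D R"
    and comm: "\<And>x y. x \<in> D \<Longrightarrow> y \<in> D \<Longrightarrow> x \<otimes> y = y \<otimes> x"
  shows "subfield {a \<otimes> inv b | a b. a \<in> D \<and> b \<in> D - {\<zero>}} R" (is "subfield ?L R")
proof -
  note D = subringE[OF sub] and Units_closed [simp]
  have DR: "a \<in> carrier R" if "a \<in> D" for a using that D(1) by blast
  have DU: "b \<in> Units R" if "b \<in> D - {\<zero>}" for b using that D(1) division by blast
  have Dmult: "b \<otimes> d \<in> D - {\<zero>}" if "b \<in> D - {\<zero>}" "d \<in> D - {\<zero>}" for b d
    using that D(6) Units_m_closed[OF DU[OF that(1)] DU[OF that(2)]] division by auto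
  have inv_comm: "a \<otimes> inv b = inv b \<otimes> a" if "a \<in> D" "b \<in> D - {\<zero>}" for a b
    using inv_commute[OF DR DU] comm that by blast
  have inv_prod: "inv b \<otimes> inv d = inv (b \<otimes> d)" if "b \<in> D - {\<zero>}" "d \<in> D - {\<zero>}" for b d
  proof -
    have "(inv b \<otimes> inv d) \<otimes> (d \<otimes> b) = \<one>"
    proof -
      have "(inv b \<otimes> inv d) \<otimes> (d \<otimes> b) = inv b \<otimes> ((inv d \<otimes> d) \<otimes> b)"
        using DU[OF that(1)] DU[OF that(2)] by (simp add: m_assoc Units_closed del: Units_l_inv)
      then show ?thesis using DU[OF that(1)] DU[OF that(2)] by simp
    qed
    then show ?thesis
      using inv_unique[of "inv b \<otimes> inv d" "b \<otimes> d" "inv (b \<otimes> d)"] comm[of b d] that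
        DU[OF that(1)] DU[OF that(2)] by auto
  qed
  have mult: "(a \<otimes> inv b) \<otimes> (c \<otimes> inv d) = (a \<otimes> c) \<otimes> inv (b \<otimes> d)"
    if "a \<in> D" "b \<in> D - {\<zero>}" "c \<in> D" "d \<in> D - {\<zero>}" for a b c d
  proof -
    have "(a \<otimes> inv b) \<otimes> (c \<otimes> inv d) = a \<otimes> ((inv b \<otimes> c) \<otimes> inv d)"
      using that DR DU by (simp add: m_assoc)
    also have "\<dots> = (a \<otimes> c) \<otimes> (inv b \<otimes> inv d)"
      using that DR DU by (simp add: m_assoc inv_comm[symmetric])
    finally show ?thesis using inv_prod that by simp
  qed
  have expand: "a \<otimes> inv b = (a \<otimes> d) \<otimes> inv (b \<otimes> d)" if "a \<in> D" "b \<in> D - {\<zero>}" "d \<in> D - {\<zero>}" for a b d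
    using mult[of a b d d] that DR DU by simp
  have mem: "a \<otimes> inv b \<in> ?L" if "a \<in> D" "b \<in> D - {\<zero>}" for a b using that by blast
  have one_D: "\<one> \<in> D - {\<zero>}" using D(3) one by simp
  show ?thesis
  proof (rule subfield_of_division_ringI[OF division one])
    show "subring ?L R"
    proof (rule subringI)
      show "?L \<subseteq> carrier R" using DR DU by auto
      show "\<one> \<in> ?L" using mem[of \<one> \<one>] one_D by simp
      fix x assume "x \<in> ?L"
      then obtain a b where x: "x = a \<otimes> inv b" "a \<in> D" "b \<in> D - {\<zero>}" by blast
      have "\<ominus> x = (\<ominus> a) \<otimes> inv b" unfolding x(1) using x(2,3) DR DU by (simp add: l_minus)
      then show "\<ominus> x \<in> ?L" using mem[of "\<ominus> a" b] D(5) x(2,3) by simp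
      fix y assume "y \<in> ?L"
      then obtain c d where y: "y = c \<otimes> inv d" "c \<in> D" "d \<in> D - {\<zero>}" by blast
      show "x \<otimes> y \<in> ?L"
        unfolding x(1) y(1) mult[OF x(2,3) y(2,3)] by (rule mem[OF D(6)[OF x(2) y(2)] Dmult[OF x(3) y(3)]])
      have "x \<oplus> y = (a \<otimes> d) \<otimes> inv (b \<otimes> d) \<oplus> (c \<otimes> b) \<otimes> inv (b \<otimes> d)"
        unfolding x(1) y(1) expand[OF x(2,3) y(3)] expand[OF y(2,3) x(3)]
        using comm[of d b] x(3) y(3) by simp
      also have "\<dots> = (a \<otimes> d \<oplus> c \<otimes> b) \<otimes> inv (b \<otimes> d)"
        using DR DU x y Dmult[OF x(3) y(3)] by (simp add: l_distr)
      finally have sum: "x \<oplus> y = (a \<otimes> d \<oplus> c \<otimes> b) \<otimes> inv (b \<otimes> d)" .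
      have "a \<otimes> d \<oplus> c \<otimes> b \<in> D" using D(6,7) x(2,3) y(2,3) by simp
      then show "x \<oplus> y \<in> ?L" unfolding sum by (rule mem[OF _ Dmult[OF x(3) y(3)]])
    qed
  next
    fix x y assume "x \<in> ?L" "y \<in> ?L"
    then obtain a b c d where x: "x = a \<otimes> inv b" "a \<in> D" "b \<in> D - {\<zero>}"
      and y: "y = c \<otimes> inv d" "c \<in> D" "d \<in> D - {\<zero>}" by blast
    show "x \<otimes> y = y \<otimes> x"
      unfolding x(1) y(1) mult[OF x(2,3) y(2,3)] mult[OF y(2,3) x(2,3)]
      using comm[of a c] comm[of b d] x y by simp
  next
    fix x assume "x \<in> ?L - {\<zero>}"
    then obtain a b where x: "x = a \<otimes> inv b" "a \<in> D" "b \<in> D - {\<zero>}" and "x \<noteq> \<zero>" by blast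
    then have a: "a \<in> D - {\<zero>}" using DU by auto
    have ab: "a \<otimes> b \<in> Units R" using DU[OF Dmult[OF a x(3)]] .
    have "(b \<otimes> inv a) \<otimes> x = (a \<otimes> b) \<otimes> inv (a \<otimes> b)"
      unfolding x(1) using mult[of b a a b] a x(3) comm[of a b] by simp
    also have "\<dots> = \<one>" using ab by simp
    finally have "(b \<otimes> inv a) \<otimes> x = \<one>" .
    moreover have "x \<in> carrier R" unfolding x(1) using DR DU x(2,3) by simp
    moreover from this have "x \<in> Units R" using \<open>x \<noteq> \<zero>\<close> division by simp
    ultimately have "inv x = b \<otimes> inv a"
      using inv_unique[of "b \<otimes> inv a" x "inv x"] DR[of b] DU[OF a] x(3) by simp
    then show "inv x \<in> ?L" using mem[of b a] a x(3) by simp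
  qed
qed

text \<open>
  The only one-sided ideals are zero and the whole ring.
\<close>

lemma division_ring_artinian:
  fixes R :: "('a, 'm) ring_scheme"
  assumes "division_ring R"
  shows "artinian_ring R"
proof -
  interpret ring R using assms unfolding division_ring_def by blast
  have division: "Units R = carrier R - {\<zero>\<^bsub>R\<^esub>}" using assms unfolding division_ring_def by blast
  have dcc: "\<exists>m. \<forall>n\<ge>m. I n = I m"
    if trivial: "\<And>n. I n = {\<zero>\<^bsub>R\<^esub>} \<or> I n = carrier R" and dec: "\<And>n. I (Suc n) \<subseteq> I n"
    for I :: "nat \<Rightarrow> 'a set"
  proof (cases "\<exists>m. I m = {\<zero>\<^bsub>R\<^esub>}")
    case True
    then obtain m where m: "I m = {\<zero>\<^bsub>R\<^esub>}" by blast
    have "I n = I m" if "n \<ge> m" for n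
    proof -
      have "I n \<subseteq> I m" using lift_Suc_antimono_le[of I, OF dec that] .
      moreover have "\<zero>\<^bsub>R\<^esub> \<in> I n" using trivial[of n] by auto
      ultimately show ?thesis unfolding m by auto
    qed
    then show ?thesis by blast
  next
    case False
    then show ?thesis using trivial by blast
  qed
  have left: "I = {\<zero>\<^bsub>R\<^esub>} \<or> I = carrier R" if I: "left_ideal I R" for I
  proof (cases "I \<subseteq> {\<zero>\<^bsub>R\<^esub>}")
    case True
    then show ?thesis using I additive_subgroup.zero_closed unfolding left_ideal_def by blast
  next
    case False
    then obtain a where a: "a \<in> I" "a \<noteq> \<zero>\<^bsub>R\<^esub>" by blast
    have sub: "I \<subseteq> carrier R" using I additive_subgroup.a_subset unfolding left_ideal_def by blast
    then have U: "a \<in> Units R" using a division by blast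
    have "x \<in> I" if x: "x \<in> carrier R" for x
    proof -
      have "(x \<otimes>\<^bsub>R\<^esub> inv\<^bsub>R\<^esub> a) \<otimes>\<^bsub>R\<^esub> a \<in> I" using I a(1) x U unfolding left_ideal_def by simp
      then show ?thesis using x U by (simp add: m_assoc Units_closed)
    qed
    then show ?thesis using sub by blast
  qed
  have right: "I = {\<zero>\<^bsub>R\<^esub>} \<or> I = carrier R" if I: "right_ideal I R" for I
  proof (cases "I \<subseteq> {\<zero>\<^bsub>R\<^esub>}")
    case True
    then show ?thesis using I additive_subgroup.zero_closed unfolding right_ideal_def by blast
  next
    case False
    then obtain a where a: "a \<in> I" "a \<noteq> \<zero>\<^bsub>R\<^esub>" by blast
    have sub: "I \<subseteq> carrier R" using I additive_subgroup.a_subset unfolding right_ideal_def by blast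
    then have U: "a \<in> Units R" using a division by blast
    have "x \<in> I" if x: "x \<in> carrier R" for x
    proof -
      have "a \<otimes>\<^bsub>R\<^esub> (inv\<^bsub>R\<^esub> a \<otimes>\<^bsub>R\<^esub> x) \<in> I" using I a(1) x U unfolding right_ideal_def by simp
      then show ?thesis using x U by (simp add: m_assoc[symmetric] Units_closed)
    qed
    then show ?thesis using sub by blast
  qed
  show ?thesis unfolding artinian_ring_def
  proof (intro conjI allI impI)
    show "ring R" by (rule ring_axioms)
    fix I :: "nat \<Rightarrow> 'a set"
    assume dec: "\<forall>n. I (Suc n) \<subseteq> I n"
    show "\<exists>m. \<forall>n\<ge>m. I n = I m" if "\<forall>n. left_ideal (I n) R"
      by (rule dcc) (use left that dec in simp_all)
    show "\<exists>m. \<forall>n\<ge>m. I n = I m" if "\<forall>n. right_ideal (I n) R"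
      by (rule dcc) (use right that dec in simp_all)
  qed
qed

section \<open>Linear combinations indexed by a finite set\<close>

lemma (in ring) finsum_in_add_subgroup:
  assumes "subgroup W (add_monoid R)" and "f \<in> A \<rightarrow> W"
  shows "(\<Oplus>i\<in>A. f i) \<in> W"
  using assms(2)
proof (induction A rule: infinite_finite_induct)
  case (insert i A)
  have "W \<subseteq> carrier R" using add.subgroupE(1)[OF assms(1)] .
  then have "(\<Oplus>i\<in>insert i A. f i) = f i \<oplus> (\<Oplus>i\<in>A. f i)"
    using insert by (intro finsum_insert) auto
  then show ?case using insert add.subgroupE(4)[OF assms(1)] by auto
qed (use subgroup.one_closed[OF assms(1)] in auto)

text \<open>
  Spans and independence are defined through lists of coefficients. The next three lemmas restate
  them with families indexed by a finite set, the form in which sums over a group appear.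
\<close>

lemma (in ring) combine_map_eq_finsum:
  assumes "distinct is" and "\<And>i. i \<in> set is \<Longrightarrow> l i \<in> carrier R" and "\<And>i. i \<in> set is \<Longrightarrow> v i \<in> carrier R"
  shows "combine (map l is) (map v is) = (\<Oplus>i\<in>set is. l i \<otimes> v i)"
  using assms by (induction "is") (auto simp: Pi_def)

lemma (in ring) Span_map_eq_finsum:
  assumes "subfield K R" and "distinct is" and "\<And>i. i \<in> set is \<Longrightarrow> v i \<in> carrier R"
  shows "Span K (map v is) = {(\<Oplus>i\<in>set is. l i \<otimes> v i) | l. l \<in> set is \<rightarrow> K}"
proof -
  have K: "K \<subseteq> carrier R" using subfieldE(3)[OF assms(1)] .
  have v: "set (map v is) \<subseteq> carrier R" using assms(3) by auto
  have 1: "\<exists>l \<in> set is \<rightarrow> K. x = (\<Oplus>i\<in>set is. l i \<otimes> v i)"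
    if Ks: "set Ks \<subseteq> K" "length Ks = length is" "x = combine Ks (map v is)" for x Ks
  proof -
    define l where "l = (\<lambda>i. the (map_of (zip is Ks) i))"
    have lKs: "map l is = Ks"
      unfolding l_def using Ks(2) assms(2) by (intro nth_equalityI) (auto simp: map_of_zip_nth)
    then have l: "l \<in> set is \<rightarrow> K" using Ks(1) by auto
    then have "x = (\<Oplus>i\<in>set is. l i \<otimes> v i)"
      using Ks(3) combine_map_eq_finsum[OF assms(2), of l v] K assms(3) lKs by auto
    then show ?thesis using l by blast
  qed
  have 2: "(\<Oplus>i\<in>set is. l i \<otimes> v i) = combine (map l is) (map v is)" if "l \<in> set is \<rightarrow> K" for l
    using that K assms(3) by (intro combine_map_eq_finsum[OF assms(2), symmetric]) auto
  show ?thesis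
  proof (intro equalityI subsetI)
    fix x assume "x \<in> Span K (map v is)"
    then show "x \<in> {(\<Oplus>i\<in>set is. l i \<otimes> v i) | l. l \<in> set is \<rightarrow> K}"
      using Span_mem_iff_length_version[OF assms(1) v] 1 by fastforce
  next
    fix x assume "x \<in> {(\<Oplus>i\<in>set is. l i \<otimes> v i) | l. l \<in> set is \<rightarrow> K}"
    then obtain l where l: "l \<in> set is \<rightarrow> K" "x = (\<Oplus>i\<in>set is. l i \<otimes> v i)" by blast
    have "set (map l is) \<subseteq> K" "length (map l is) = length (map v is)" using l(1) by auto
    then show "x \<in> Span K (map v is)"
      using Span_mem_iff_length_version[OF assms(1) v] 2[OF l(1)] l(2) by blast
  qed
qed

lemma (in ring) independent_map_finsumI:
  assumes "subfield K R" and "distinct is" and "\<And>i. i \<in> set is \<Longrightarrow> v i \<in> carrier R"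
    and indep: "\<And>l i. l \<in> set is \<rightarrow> K \<Longrightarrow> (\<Oplus>i\<in>set is. l i \<otimes> v i) = \<zero> \<Longrightarrow> i \<in> set is \<Longrightarrow> l i = \<zero>"
  shows "independent K (map v is)"
proof (rule ccontr)
  have K: "K \<subseteq> carrier R" using subfieldE(3)[OF assms(1)] .
  have v: "set (map v is) \<subseteq> carrier R" using assms(3) by auto
  assume "dependent K (map v is)"
  then obtain Ks where Ks: "length Ks = length (map v is)" "combine Ks (map v is) = \<zero>"
    "set Ks \<subseteq> K" "set Ks \<noteq> {\<zero>}"
    using dependent_imp_non_trivial_combine[OF assms(1) v] by blast
  define l where "l = (\<lambda>i. the (map_of (zip is Ks) i))"
  have lKs: "map l is = Ks"
    unfolding l_def using Ks(1) assms(2) by (intro nth_equalityI) (auto simp: map_of_zip_nth)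
  then have l: "l \<in> set is \<rightarrow> K" using Ks(3) by auto
  then have "(\<Oplus>i\<in>set is. l i \<otimes> v i) = \<zero>"
    using Ks(2) lKs K assms(3) combine_map_eq_finsum[OF assms(2), of l v] by (metis PiE subsetD)
  then have "\<And>i. i \<in> set is \<Longrightarrow> l i = \<zero>" using indep[OF l] by blast
  then have "set Ks \<subseteq> {\<zero>}" using lKs by auto
  then have "Ks = []" using Ks(4) by (cases Ks) auto
  then have "is = []" using Ks(1) by simp
  then show False using \<open>dependent K (map v is)\<close> by simp
qed

section \<open>A subfield of a division ring and a finite group normalizing it\<close>

text \<open>
  The situation of a crossed product without the assumption that the \<open>u f\<close> span the ring. The last
  assumption makes the action of the group on \<open>L\<close> faithful.
\<close>

locale normalized_subfield = ring R + F: group F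
  for R (structure) and F :: "('f, 'n) monoid_scheme" +
  fixes L and u :: "'f \<Rightarrow> 'a"
  assumes division: "Units R = carrier R - {\<zero>}"
    and subfield: "subfield L R"
    and finite_F: "finite (carrier F)"
    and u_nonzero: "f \<in> carrier F \<Longrightarrow> u f \<in> carrier R - {\<zero>}"
    and u_one: "u \<one>\<^bsub>F\<^esub> = \<one>"
    and conj_closed: "f \<in> carrier F \<Longrightarrow> p \<in> L \<Longrightarrow> u f \<otimes> p \<otimes> inv (u f) \<in> L"
    and cocycle_closed: "f \<in> carrier F \<Longrightarrow> g \<in> carrier F \<Longrightarrow>
      u f \<otimes> u g \<otimes> inv (u (f \<otimes>\<^bsub>F\<^esub> g)) \<in> L"
    and faithful: "f \<in> carrier F \<Longrightarrow> g \<in> carrier F \<Longrightarrow>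
      (\<And>p. p \<in> L \<Longrightarrow> u f \<otimes> p \<otimes> inv (u f) = u g \<otimes> p \<otimes> inv (u g)) \<Longrightarrow> f = g"
begin

\<comment> \<open>Unfolding spans into iterated line extensions would hide every lemma about them.\<close>
declare Span.simps [simp del]

definition act where "act f p = u f \<otimes> p \<otimes> inv (u f)"
definition cocycle where "cocycle f g = u f \<otimes> u g \<otimes> inv (u (f \<otimes>\<^bsub>F\<^esub> g))"
definition lincomb where "lincomb l A = (\<Oplus>f\<in>A. l f \<otimes> u f)"
definition combs where "combs = {lincomb l (carrier F) | l. l \<in> carrier F \<rightarrow> L}"

lemmas L_subring = subfieldE(1)[OF subfield]
lemmas L_closed = subringE[OF L_subring]
lemmas L_comm = subfieldE(4)[OF subfield]

lemma L_carrier [simp]: "p \<in> L \<Longrightarrow> p \<in> carrier R"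
  using L_closed(1) by blast

lemma coeffs_carrier: "l \<in> A \<rightarrow> L \<Longrightarrow> l \<in> A \<rightarrow> carrier R"
  using L_carrier by blast

lemma u_unit [simp]: "f \<in> carrier F \<Longrightarrow> u f \<in> Units R"
  using u_nonzero division by simp

lemma u_carrier [simp]: "f \<in> carrier F \<Longrightarrow> u f \<in> carrier R"
  using u_nonzero by simp

lemma one_not_zero: "\<one> \<noteq> \<zero>"
  using subfieldE(6)[OF subfield] .

lemma zero_divisor:
  assumes "x \<in> carrier R" "y \<in> carrier R" "x \<otimes> y = \<zero>" shows "x = \<zero> \<or> y = \<zero>"
proof (rule disjCI)
  assume "y \<noteq> \<zero>"
  then have y: "y \<in> Units R" using assms division by simp
  have "x = (x \<otimes> y) \<otimes> inv y" using y assms(1,2) by (simp add: m_assoc)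
  then show "x = \<zero>" using assms(3) y by simp
qed

lemma conj_carrier [simp]: "f \<in> carrier F \<Longrightarrow> p \<in> carrier R \<Longrightarrow> act f p \<in> carrier R"
  unfolding act_def by simp

lemma conj_in_L [simp]: "f \<in> carrier F \<Longrightarrow> p \<in> L \<Longrightarrow> act f p \<in> L"
  unfolding act_def by (rule conj_closed)

lemma cocycle_in_L [simp]: "f \<in> carrier F \<Longrightarrow> g \<in> carrier F \<Longrightarrow> cocycle f g \<in> L"
  unfolding cocycle_def by (rule cocycle_closed)

lemma u_commute: "f \<in> carrier F \<Longrightarrow> p \<in> carrier R \<Longrightarrow> u f \<otimes> p = act f p \<otimes> u f"
  unfolding act_def by (simp add: m_assoc)

lemma u_mult: "f \<in> carrier F \<Longrightarrow> g \<in> carrier F \<Longrightarrow> u f \<otimes> u g = cocycle f g \<otimes> u (f \<otimes>\<^bsub>F\<^esub> g)"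
  unfolding cocycle_def by (simp add: m_assoc)

lemma cancel_u:
  assumes "f \<in> carrier F" "x \<in> carrier R" "y \<in> carrier R" "x \<otimes> u f = y \<otimes> u f"
  shows "x = y"
proof -
  have "x = x \<otimes> u f \<otimes> inv (u f)" "y = y \<otimes> u f \<otimes> inv (u f)"
    using assms(1-3) by (simp_all add: m_assoc)
  then show ?thesis using assms(4) by simp
qed

lemma cocycle_nonzero: 
  assumes "f \<in> carrier F" "g \<in> carrier F" shows "cocycle f g \<noteq> \<zero>"
proof
  assume "cocycle f g = \<zero>"
  then have "u f \<otimes> u g = \<zero>" using u_mult[OF assms] assms by simp
  then show False using zero_divisor[of "u f" "u g"] u_nonzero assms by auto
qed

lemma conj_one: "p \<in> carrier R \<Longrightarrow> act \<one>\<^bsub>F\<^esub> p = p"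
  unfolding act_def by (simp add: u_one)

lemma cocycle_one: "f \<in> carrier F \<Longrightarrow> cocycle \<one>\<^bsub>F\<^esub> f = \<one>" "f \<in> carrier F \<Longrightarrow> cocycle f \<one>\<^bsub>F\<^esub> = \<one>"
  unfolding cocycle_def by (simp_all add: u_one)

lemma conj_zero: "f \<in> carrier F \<Longrightarrow> act f \<zero> = \<zero>"
  unfolding act_def by simp

lemma conj_add:
  assumes "f \<in> carrier F" "p \<in> carrier R" "q \<in> carrier R"
  shows "act f (p \<oplus> q) = act f p \<oplus> act f q"
  unfolding act_def using assms by (simp add: l_distr r_distr)

lemma conj_mult:
  assumes "f \<in> carrier F" "p \<in> carrier R" "q \<in> carrier R"
  shows "act f (p \<otimes> q) = act f p \<otimes> act f q"
proof -
  have "inv (u f) \<otimes> (u f \<otimes> (q \<otimes> inv (u f))) = q \<otimes> inv (u f)"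
    using assms by (simp add: m_assoc[symmetric])
  then show ?thesis unfolding act_def using assms by (simp add: m_assoc)
qed

lemma conj_cocycle:
  assumes "f \<in> carrier F" "g \<in> carrier F" "r \<in> carrier R"
  shows "cocycle f g \<otimes> act (f \<otimes>\<^bsub>F\<^esub> g) r = act f (act g r) \<otimes> cocycle f g"
proof (rule cancel_u[of "f \<otimes>\<^bsub>F\<^esub> g"])
  have "cocycle f g \<otimes> act (f \<otimes>\<^bsub>F\<^esub> g) r \<otimes> u (f \<otimes>\<^bsub>F\<^esub> g) = cocycle f g \<otimes> u (f \<otimes>\<^bsub>F\<^esub> g) \<otimes> r"
    using assms by (simp add: m_assoc u_commute[symmetric])
  also have "\<dots> = u f \<otimes> u g \<otimes> r" using assms u_mult by simp
  also have "\<dots> = u f \<otimes> (act g r \<otimes> u g)" using assms u_commute[of g r] by (simp add: m_assoc)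
  also have "\<dots> = act f (act g r) \<otimes> (u f \<otimes> u g)"
    using assms u_commute[of f "act g r"] by (simp add: m_assoc[symmetric])
  also have "\<dots> = act f (act g r) \<otimes> cocycle f g \<otimes> u (f \<otimes>\<^bsub>F\<^esub> g)" using assms u_mult by (simp add: m_assoc)
  finally show "cocycle f g \<otimes> act (f \<otimes>\<^bsub>F\<^esub> g) r \<otimes> u (f \<otimes>\<^bsub>F\<^esub> g) = act f (act g r) \<otimes> cocycle f g \<otimes> u (f \<otimes>\<^bsub>F\<^esub> g)" .
qed (use assms in auto)

text \<open>
  \<open>act\<close> respects products only up to conjugation by the cocycle, and this conjugation is trivial on
  the commutative \<open>L\<close>.
\<close>

lemma conj_comp:
  assumes "f \<in> carrier F" "g \<in> carrier F" "r \<in> L"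
  shows "act (f \<otimes>\<^bsub>F\<^esub> g) r = act f (act g r)"
proof -
  have "cocycle f g \<otimes> act (f \<otimes>\<^bsub>F\<^esub> g) r = cocycle f g \<otimes> act f (act g r)"
    using conj_cocycle[OF assms(1,2), of r] assms L_comm[of "act f (act g r)" "cocycle f g"] by simp
  moreover have "cocycle f g \<in> Units R" using cocycle_nonzero assms division by simp
  ultimately show ?thesis using assms by simp
qed

lemma cocycle_identity:
  assumes "g \<in> carrier F" "h \<in> carrier F" "f \<in> carrier F"
  shows "cocycle g h \<otimes> cocycle (g \<otimes>\<^bsub>F\<^esub> h) f = act g (cocycle h f) \<otimes> cocycle g (h \<otimes>\<^bsub>F\<^esub> f)"
proof (rule cancel_u[of "g \<otimes>\<^bsub>F\<^esub> h \<otimes>\<^bsub>F\<^esub> f"])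
  have "cocycle g h \<otimes> cocycle (g \<otimes>\<^bsub>F\<^esub> h) f \<otimes> u (g \<otimes>\<^bsub>F\<^esub> h \<otimes>\<^bsub>F\<^esub> f) = cocycle g h \<otimes> u (g \<otimes>\<^bsub>F\<^esub> h) \<otimes> u f"
    using assms by (simp add: m_assoc u_mult)
  also have "\<dots> = u g \<otimes> (u h \<otimes> u f)" using assms by (simp add: u_mult[symmetric] m_assoc)
  also have "\<dots> = u g \<otimes> cocycle h f \<otimes> u (h \<otimes>\<^bsub>F\<^esub> f)" using assms by (simp add: u_mult m_assoc)
  also have "\<dots> = act g (cocycle h f) \<otimes> (u g \<otimes> u (h \<otimes>\<^bsub>F\<^esub> f))"
    using assms by (simp add: u_commute m_assoc)
  also have "\<dots> = act g (cocycle h f) \<otimes> cocycle g (h \<otimes>\<^bsub>F\<^esub> f) \<otimes> u (g \<otimes>\<^bsub>F\<^esub> h \<otimes>\<^bsub>F\<^esub> f)"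
    using assms by (simp add: u_mult m_assoc F.m_assoc)
  finally show "cocycle g h \<otimes> cocycle (g \<otimes>\<^bsub>F\<^esub> h) f \<otimes> u (g \<otimes>\<^bsub>F\<^esub> h \<otimes>\<^bsub>F\<^esub> f) =
    act g (cocycle h f) \<otimes> cocycle g (h \<otimes>\<^bsub>F\<^esub> f) \<otimes> u (g \<otimes>\<^bsub>F\<^esub> h \<otimes>\<^bsub>F\<^esub> f)" .
qed (use assms in auto)

lemma term_mult:
  assumes "f \<in> carrier F" "g \<in> carrier F" "p \<in> L" "q \<in> L"
  shows "(p \<otimes> u f) \<otimes> (q \<otimes> u g) = (p \<otimes> act f q \<otimes> cocycle f g) \<otimes> u (f \<otimes>\<^bsub>F\<^esub> g)"
proof -
  have "(p \<otimes> u f) \<otimes> (q \<otimes> u g) = p \<otimes> ((u f \<otimes> q) \<otimes> u g)" using assms by (simp add: m_assoc)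
  also have "\<dots> = p \<otimes> (act f q \<otimes> (u f \<otimes> u g))" using assms by (simp add: u_commute m_assoc)
  finally show ?thesis using assms by (simp add: u_mult m_assoc)
qed

text \<open>
  Surjectivity is the point: \<open>act (inv f)\<close> provides preimages by \<open>conj_comp\<close>.
\<close>

lemma conj_ring_iso:
  assumes f: "f \<in> carrier F"
  shows "act f \<in> ring_iso (R\<lparr>carrier := L\<rparr>) (R\<lparr>carrier := L\<rparr>)"
proof -
  have one: "act f \<one> = \<one>" unfolding act_def using f by simp
  have "act f ` L = L"
  proof
    show "act f ` L \<subseteq> L" using f by auto
    show "L \<subseteq> act f ` L"
    proof
      fix p assume p: "p \<in> L"
      have "p = act f (act (inv\<^bsub>F\<^esub> f) p)"
        using conj_comp[OF f F.inv_closed[OF f] p] f p by (simp add: conj_one)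
      then show "p \<in> act f ` L" using f p by (intro image_eqI[of _ _ "act (inv\<^bsub>F\<^esub> f) p"]) auto
    qed
  qed
  moreover have "inj_on (act f) L"
  proof (rule inj_onI)
    fix p q assume pq: "p \<in> L" "q \<in> L" "act f p = act f q"
    then have "u f \<otimes> p = u f \<otimes> q" using f by (simp add: u_commute)
    then show "p = q" using f pq by simp
  qed
  ultimately show ?thesis unfolding ring_iso_def ring_hom_def bij_betw_def
    using f one by (auto simp: conj_add conj_mult)
qed

lemma lincomb_carrier [simp]: "l \<in> A \<rightarrow> carrier R \<Longrightarrow> A \<subseteq> carrier F \<Longrightarrow> lincomb l A \<in> carrier R"
  unfolding lincomb_def by (rule finsum_closed) (auto simp: Pi_def subset_iff)

lemma lincomb_insert:
  assumes "finite A" "g \<notin> A" "insert g A \<subseteq> carrier F" "l \<in> insert g A \<rightarrow> carrier R"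
  shows "lincomb l (insert g A) = l g \<otimes> u g \<oplus> lincomb l A"
  unfolding lincomb_def using assms by (intro finsum_insert) (auto simp: Pi_def subset_iff)

lemma lincomb_smult:
  assumes "l \<in> A \<rightarrow> carrier R" "A \<subseteq> carrier F" "p \<in> carrier R"
  shows "p \<otimes> lincomb l A = lincomb (\<lambda>f. p \<otimes> l f) A"
proof -
  have fin: "finite A" using assms(2) finite_F finite_subset by blast
  have "p \<otimes> lincomb l A = (\<Oplus>f\<in>A. p \<otimes> (l f \<otimes> u f))"
    unfolding lincomb_def using assms fin by (intro finsum_rdistr) (auto simp: Pi_def subset_iff)
  also have "\<dots> = lincomb (\<lambda>f. p \<otimes> l f) A"
    unfolding lincomb_def using assms by (intro finsum_cong') (auto simp: m_assoc Pi_def subset_iff)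
  finally show ?thesis .
qed

lemma lincomb_mult_right:
  assumes "l \<in> A \<rightarrow> carrier R" "A \<subseteq> carrier F" "p \<in> carrier R"
  shows "lincomb l A \<otimes> p = lincomb (\<lambda>f. l f \<otimes> act f p) A"
proof -
  have fin: "finite A" using assms(2) finite_F finite_subset by blast
  have "lincomb l A \<otimes> p = (\<Oplus>f\<in>A. l f \<otimes> u f \<otimes> p)"
    unfolding lincomb_def using assms fin by (intro finsum_ldistr) (auto simp: Pi_def subset_iff)
  also have "\<dots> = lincomb (\<lambda>f. l f \<otimes> act f p) A"
    unfolding lincomb_def using assms
    by (intro finsum_cong') (auto simp: m_assoc Pi_def subset_iff u_commute)
  finally show ?thesis .
qed

lemma lincomb_add:
  assumes "l \<in> A \<rightarrow> carrier R" "m \<in> A \<rightarrow> carrier R" "A \<subseteq> carrier F"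
  shows "lincomb l A \<oplus> lincomb m A = lincomb (\<lambda>f. l f \<oplus> m f) A"
proof -
  have "lincomb (\<lambda>f. l f \<oplus> m f) A = (\<Oplus>f\<in>A. l f \<otimes> u f \<oplus> m f \<otimes> u f)"
    unfolding lincomb_def using assms by (intro finsum_cong') (auto simp: l_distr Pi_def subset_iff)
  also have "\<dots> = lincomb l A \<oplus> lincomb m A"
    unfolding lincomb_def using assms by (intro finsum_addf) (auto simp: Pi_def subset_iff)
  finally show ?thesis by simp
qed

lemma lincomb_diff:
  assumes "l \<in> A \<rightarrow> carrier R" "m \<in> A \<rightarrow> carrier R" "A \<subseteq> carrier F"
  shows "lincomb l A \<ominus> lincomb m A = lincomb (\<lambda>f. l f \<ominus> m f) A"
proof -
  have "lincomb (\<lambda>f. l f \<ominus> m f) A \<oplus> lincomb m A = lincomb (\<lambda>f. l f \<ominus> m f \<oplus> m f) A"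
    using assms by (intro lincomb_add) (auto simp: Pi_def)
  also have "\<dots> = lincomb l A" unfolding lincomb_def
    by (rule finsum_cong') (use assms in \<open>auto simp: minus_eq a_assoc l_neg Pi_def\<close>)
  finally have "lincomb l A = lincomb (\<lambda>f. l f \<ominus> m f) A \<oplus> lincomb m A" by simp
  moreover have "lincomb (\<lambda>f. l f \<ominus> m f) A \<in> carrier R" "lincomb m A \<in> carrier R"
    using assms by (auto intro!: lincomb_carrier simp: Pi_def)
  ultimately show ?thesis by (simp add: minus_eq a_assoc r_neg)
qed

text \<open>
  Dedekind's elimination. Let \<open>x\<close> be the given sum, and \<open>g\<close> one of its indices. For \<open>a \<in> L\<close> the element
  \<open>act g a \<otimes> x \<ominus> x \<otimes> a\<close> of \<open>W\<close> has the coefficients \<open>(act g a \<ominus> act f a) \<otimes> l f\<close>, so the term at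
  \<open>g\<close> disappears and the induction hypothesis applies. To recover the term at \<open>h\<close>, choose \<open>a\<close> with
  \<open>act g a \<noteq> act h a\<close> and divide. The term at \<open>g\<close> is then the difference of \<open>x\<close> and the others.
\<close>

lemma term_in_sub_bimodule:
  assumes W: "subgroup W (add_monoid R)"
    and left: "\<And>p w. p \<in> L \<Longrightarrow> w \<in> W \<Longrightarrow> p \<otimes> w \<in> W"
    and right: "\<And>p w. p \<in> L \<Longrightarrow> w \<in> W \<Longrightarrow> w \<otimes> p \<in> W"
    and A: "A \<subseteq> carrier F" and l: "l \<in> A \<rightarrow> L" and mem: "lincomb l A \<in> W" and f: "f \<in> A"
  shows "l f \<otimes> u f \<in> W"
proof -
  have "finite A" using A finite_F finite_subset by blast
  then show ?thesis using A l mem f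
  proof (induction A arbitrary: l f)
    case (insert g A)
    have W_sub: "W \<subseteq> carrier R" using add.subgroupE(1)[OF W] .
    have W_diff: "x \<ominus> y \<in> W" if "x \<in> W" "y \<in> W" for x y
      using that add.subgroupE(3,4)[OF W] by (simp add: minus_eq a_inv_def)
    have g: "g \<in> carrier F" and AF: "A \<subseteq> carrier F" using insert.prems(1) by auto
    have lR: "l \<in> insert g A \<rightarrow> carrier R" using insert.prems(2) by (auto simp: Pi_def)
    have terms_A: "l h \<otimes> u h \<in> W" if h: "h \<in> A" for h
    proof -
      have "h \<noteq> g" using h insert.hyps(2) by blast
      then obtain a where a: "a \<in> L" and ne: "act g a \<noteq> act h a"
        using faithful[of g h] g AF h unfolding act_def by blast
      define m where "m = (\<lambda>f. (act g a \<ominus> act f a) \<otimes> l f)"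
      have hF: "h \<in> carrier F" using AF h by blast
      have mL: "m \<in> insert g A \<rightarrow> L" unfolding m_def
        using insert.prems(1,2) a g L_closed(5,6,7) by (auto simp: Pi_def minus_eq subset_iff)
      have "act g a \<otimes> lincomb l (insert g A) \<ominus> lincomb l (insert g A) \<otimes> a =
          lincomb (\<lambda>f. act g a \<otimes> l f \<ominus> l f \<otimes> act f a) (insert g A)"
        using lR insert.prems(1) a g
        by (subst lincomb_smult, simp_all, subst lincomb_mult_right, simp_all,
            intro lincomb_diff) (auto simp: Pi_def subset_iff)
      also have "\<dots> = lincomb m (insert g A)" unfolding lincomb_def
      proof (rule finsum_cong')
        show "(\<lambda>f. m f \<otimes> u f) \<in> insert g A \<rightarrow> carrier R"
          using mL insert.prems(1) by (auto simp: Pi_def subset_iff)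
        fix f assume f: "f \<in> insert g A"
        then have "f \<in> carrier F" "l f \<in> L" using insert.prems(1,2) by auto
        moreover from this have "l f \<otimes> act f a = act f a \<otimes> l f" using a L_comm by simp
        ultimately show "(act g a \<otimes> l f \<ominus> l f \<otimes> act f a) \<otimes> u f = m f \<otimes> u f"
          unfolding m_def using a g by (simp add: minus_eq l_distr l_minus)
      qed simp
      also have "\<dots> = m g \<otimes> u g \<oplus> lincomb m A"
        using insert.hyps insert.prems(1) mL by (intro lincomb_insert) (auto simp: Pi_def)
      also have "m g = \<zero>" unfolding m_def using g a lR by (simp add: minus_eq r_neg)
      finally have eq: "act g a \<otimes> lincomb l (insert g A) \<ominus> lincomb l (insert g A) \<otimes> a = lincomb m A"
        using g mL AF by (simp add: Pi_def)
      have "lincomb m A \<in> W" unfolding eq[symmetric]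
        using W_diff left right insert.prems(3) a g by simp
      then have "m h \<otimes> u h \<in> W" using insert.IH[of m h] AF mL h by auto
      then have w: "(act g a \<ominus> act h a) \<otimes> (l h \<otimes> u h) \<in> W"
        unfolding m_def using a g hF lR h by (simp add: m_assoc Pi_def)
      define d where "d = act g a \<ominus> act h a"
      have d: "d \<in> L - {\<zero>}" unfolding d_def
        using a g hF ne L_closed(5,7) by (auto simp: minus_eq) (metis (no_types, lifting) L_carrier conj_in_L minus_eq r_right_minus_eq)
      have "inv d \<otimes> (d \<otimes> (l h \<otimes> u h)) \<in> W"
        using left subfield_m_inv(1)[OF subfield d] w unfolding d_def by blast
      moreover have "inv d \<otimes> (d \<otimes> (l h \<otimes> u h)) = l h \<otimes> u h"
        using subfield_m_inv[OF subfield d] d lR h hF by (simp add: m_assoc[symmetric] Pi_def)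
      ultimately show ?thesis by simp
    qed
    show ?case
    proof (cases "f = g")
      case True
      have "lincomb l A \<in> W" unfolding lincomb_def
        by (rule finsum_in_add_subgroup[OF W]) (use terms_A in auto)
      then have "lincomb l (insert g A) \<ominus> lincomb l A \<in> W" using W_diff insert.prems(3) by blast
      moreover have "lincomb l (insert g A) \<ominus> lincomb l A = l g \<otimes> u g"
        using lincomb_insert[OF insert.hyps(1,2) insert.prems(1) lR] lR g AF
        by (simp add: minus_eq a_assoc r_neg Pi_def)
      ultimately show ?thesis using True by simp
    next
      case False
      then show ?thesis using terms_A insert.prems(4) by blast
    qed
  qed simp
qed

lemma zero_add_subgroup: "subgroup {\<zero>} (add_monoid R)"
  by (rule add.subgroupI) auto

text \<open>
  Independence is the elimination lemma for the zero bimodule.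
\<close>

lemma lincomb_eq_zero:
  assumes l: "l \<in> carrier F \<rightarrow> L" and "lincomb l (carrier F) = \<zero>" and f: "f \<in> carrier F"
  shows "l f = \<zero>"
proof -
  have "l f \<otimes> u f \<in> {\<zero>}"
    by (rule term_in_sub_bimodule[OF zero_add_subgroup _ _ _ l]) (use assms in auto)
  then show ?thesis using zero_divisor[of "l f" "u f"] u_nonzero[OF f] funcset_mem[OF l, of f] f by auto
qed

lemma lincomb_unique:
  assumes l: "l \<in> carrier F \<rightarrow> L" and m: "m \<in> carrier F \<rightarrow> L"
    and eq: "lincomb l (carrier F) = lincomb m (carrier F)" and f: "f \<in> carrier F"
  shows "l f = m f"
proof -
  have lm: "l \<in> carrier F \<rightarrow> carrier R" "m \<in> carrier F \<rightarrow> carrier R"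
    using l m coeffs_carrier by blast+
  have "lincomb (\<lambda>f. l f \<ominus> m f) (carrier F) = \<zero>"
    using lincomb_diff[OF lm] eq lincomb_carrier[OF lm(2)] by (simp add: minus_eq r_neg)
  then have "l f \<ominus> m f = \<zero>"
    using lincomb_eq_zero[of "\<lambda>f. l f \<ominus> m f"] l m L_closed(5,7) f by (auto simp: Pi_def minus_eq)
  then show ?thesis using lm f by (auto simp: Pi_def)
qed

lemma enumeration_exists:
  obtains fs where "distinct fs" and "set fs = carrier F" and "length fs = card (carrier F)"
proof -
  obtain fs where fs: "set fs = carrier F" "distinct fs"
    using finite_distinct_list[OF finite_F] by blast
  then show thesis using that distinct_card[OF fs(2)] by simp
qed

lemma Span_u:
  assumes "distinct fs" "set fs = carrier F"
  shows "Span L (map u fs) = combs"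
  unfolding combs_def lincomb_def assms(2)[symmetric]
  by (rule Span_map_eq_finsum[OF subfield assms(1)]) (simp add: assms(2))

lemma independent_u:
  assumes "distinct fs" "set fs = carrier F"
  shows "independent L (map u fs)"
proof (rule independent_map_finsumI[OF subfield assms(1)])
  show "u f \<in> carrier R" if "f \<in> set fs" for f using that assms(2) by simp
  show "l f = \<zero>" if "l \<in> set fs \<rightarrow> L" "(\<Oplus>f\<in>set fs. l f \<otimes> u f) = \<zero>" "f \<in> set fs" for l f
    using that lincomb_eq_zero[of l f] unfolding lincomb_def assms(2) by blast
qed

lemma dimension_combs: "dimension (card (carrier F)) L combs"
proof -
  obtain fs where fs: "distinct fs" "set fs = carrier F" "length fs = card (carrier F)"
    by (rule enumeration_exists)
  show ?thesis using dimensionI[OF subfield independent_u[OF fs(1,2)] Span_u[OF fs(1,2)]] fs(3) by simp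
qed

lemma combs_subalgebra: "subalgebra L combs R"
proof -
  obtain fs where fs: "distinct fs" "set fs = carrier F" by (rule enumeration_exists)
  have "set (map u fs) \<subseteq> carrier R" using fs(2) by auto
  then show ?thesis unfolding Span_u[OF fs, symmetric] by (rule Span_is_subalgebra[OF subfield])
qed

lemma combs_add_subgroup: "subgroup combs (add_monoid R)"
  using combs_subalgebra unfolding subalgebra_def by blast

lemma combs_carrier: "combs \<subseteq> carrier R"
  using subalgebra_in_carrier[OF combs_subalgebra] .

lemma u_in_combs: "f \<in> carrier F \<Longrightarrow> u f \<in> combs"
proof -
  assume f: "f \<in> carrier F"
  obtain fs where fs: "distinct fs" "set fs = carrier F" by (rule enumeration_exists)
  have "set (map u fs) \<subseteq> carrier R" using fs(2) by auto
  then show ?thesis using Span_base_incl[OF subfield, of "map u fs"] Span_u[OF fs] f fs(2) by auto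
qed

lemma term_in_combs: "f \<in> carrier F \<Longrightarrow> p \<in> L \<Longrightarrow> p \<otimes> u f \<in> combs"
  using subalgebra.smult_closed[OF combs_subalgebra] u_in_combs by blast

lemma combs_mult_closed:
  assumes x: "x \<in> combs" and y: "y \<in> combs" shows "x \<otimes> y \<in> combs"
proof -
  obtain l m where l: "l \<in> carrier F \<rightarrow> L" and m: "m \<in> carrier F \<rightarrow> L"
    and xl: "x = lincomb l (carrier F)" and ym: "y = lincomb m (carrier F)"
    using x y unfolding combs_def by blast
  have yR: "y \<in> carrier R" using y combs_carrier by blast
  have 1: "(l f \<otimes> u f) \<otimes> y \<in> combs" if f: "f \<in> carrier F" for f
  proof -
    have lf: "l f \<in> L" using l f by blast
    have "(l f \<otimes> u f) \<otimes> y = (\<Oplus>g\<in>carrier F. (l f \<otimes> u f) \<otimes> (m g \<otimes> u g))"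
      unfolding ym lincomb_def using lf m f finite_F by (intro finsum_rdistr) (auto simp: Pi_def)
    also have "\<dots> \<in> combs"
    proof (rule finsum_in_add_subgroup[OF combs_add_subgroup], rule Pi_I)
      fix g assume g: "g \<in> carrier F"
      have mg: "m g \<in> L" using m g by blast
      have "l f \<otimes> act f (m g) \<otimes> cocycle f g \<in> L" using lf mg f g L_closed(6) by simp
      then show "(l f \<otimes> u f) \<otimes> (m g \<otimes> u g) \<in> combs"
        using term_mult[OF f g lf mg] term_in_combs f g by simp
    qed
    finally show ?thesis .
  qed
  have "x \<otimes> y = (\<Oplus>f\<in>carrier F. (l f \<otimes> u f) \<otimes> y)"
    unfolding xl lincomb_def using l yR finite_F by (intro finsum_ldistr) (auto simp: Pi_def)
  also have "\<dots> \<in> combs"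
    by (rule finsum_in_add_subgroup[OF combs_add_subgroup]) (use 1 in auto)
  finally show ?thesis .
qed

text \<open>
  Right multiplication by \<open>b\<close> maps the basis to independent elements of the span. There are as many of
  them as the dimension, so they span it as well; in particular \<open>\<one>\<close> is a left multiple of \<open>b\<close>.
\<close>

lemma combs_inv_closed:
  assumes b: "b \<in> combs" and b0: "b \<noteq> \<zero>"
  shows "inv b \<in> combs"
proof -
  obtain fs where fs: "distinct fs" "set fs = carrier F" "length fs = card (carrier F)"
    by (rule enumeration_exists)
  have bR: "b \<in> carrier R" using b combs_carrier by blast
  then have bU: "b \<in> Units R" using b0 division by simp
  have shift: "(\<Oplus>f\<in>carrier F. l f \<otimes> (u f \<otimes> b)) = lincomb l (carrier F) \<otimes> b"
    if l: "l \<in> carrier F \<rightarrow> L" for l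
  proof -
    have "lincomb l (carrier F) \<otimes> b = (\<Oplus>f\<in>carrier F. (l f \<otimes> u f) \<otimes> b)"
      unfolding lincomb_def using l bR finite_F by (intro finsum_ldistr) (auto simp: Pi_def)
    also have "\<dots> = (\<Oplus>f\<in>carrier F. l f \<otimes> (u f \<otimes> b))"
      using l bR by (intro finsum_cong') (auto simp: Pi_def m_assoc)
    finally show ?thesis by simp
  qed
  have ub: "u f \<otimes> b \<in> carrier R" if "f \<in> set fs" for f using that fs(2) bR by simp
  have indep: "independent L (map (\<lambda>f. u f \<otimes> b) fs)"
  proof (rule independent_map_finsumI[OF subfield fs(1) ub])
    fix l f assume l: "l \<in> set fs \<rightarrow> L" and z: "(\<Oplus>f\<in>set fs. l f \<otimes> (u f \<otimes> b)) = \<zero>"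
      and f: "f \<in> set fs"
    have l': "l \<in> carrier F \<rightarrow> L" using l fs(2) by simp
    then have lR: "lincomb l (carrier F) \<in> carrier R" by (intro lincomb_carrier coeffs_carrier) auto
    have "lincomb l (carrier F) \<otimes> b = \<zero>" using shift[OF l'] z fs(2) by simp
    then have "lincomb l (carrier F) = \<zero>" using zero_divisor[OF lR bR] b0 by simp
    then show "l f = \<zero>" using lincomb_eq_zero[OF l'] f fs(2) by simp
  qed
  have "set (map (\<lambda>f. u f \<otimes> b) fs) \<subseteq> combs"
    using fs(2) combs_mult_closed u_in_combs b by auto
  then have span: "Span L (map (\<lambda>f. u f \<otimes> b) fs) = combs"
    using independent_length_eq_dimension[OF subfield dimension_combs indep] fs(3) by simp
  have "\<one> \<in> Span L (map (\<lambda>f. u f \<otimes> b) fs)"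
    unfolding span using u_in_combs[of "\<one>\<^bsub>F\<^esub>"] u_one by simp
  also have "\<dots> = {\<Oplus>f\<in>set fs. l f \<otimes> (u f \<otimes> b) | l. l \<in> set fs \<rightarrow> L}"
    by (rule Span_map_eq_finsum[OF subfield fs(1) ub])
  finally obtain l where l: "l \<in> carrier F \<rightarrow> L" "\<one> = (\<Oplus>f\<in>carrier F. l f \<otimes> (u f \<otimes> b))"
    unfolding fs(2) by blast
  have lR: "lincomb l (carrier F) \<in> carrier R" using l(1) by (intro lincomb_carrier coeffs_carrier) auto
  have "lincomb l (carrier F) \<otimes> b = \<one>" using shift[OF l(1)] l(2) by simp
  then have "inv b = lincomb l (carrier F)"
    using bU lR bR inv_unique[of "lincomb l (carrier F)" b "inv b"] by simp
  then show ?thesis using l(1) unfolding combs_def by blast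
qed

end

locale crossed_skew_field = normalized_subfield +
  assumes spanning: "combs = carrier R"
begin

abbreviation "fixed \<equiv> {p \<in> L. \<forall>f \<in> carrier F. act f p = p}"

lemma dimension_over_L: "dimension (card (carrier F)) L (carrier R)"
  using dimension_combs spanning by simp

lemma fixed_central:
  assumes p: "p \<in> fixed" and x: "x \<in> carrier R" shows "p \<otimes> x = x \<otimes> p"
proof -
  obtain l where l: "l \<in> carrier F \<rightarrow> L" and xl: "x = lincomb l (carrier F)"
    using x spanning unfolding combs_def by blast
  have lR: "l \<in> carrier F \<rightarrow> carrier R" using l by (rule coeffs_carrier)
  have pR: "p \<in> carrier R" using p by simp
  have "p \<otimes> x = lincomb (\<lambda>f. p \<otimes> l f) (carrier F)" unfolding xl using lincomb_smult[OF lR _ pR] by simp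
  also have "\<dots> = lincomb (\<lambda>f. l f \<otimes> act f p) (carrier F)" unfolding lincomb_def
  proof (rule finsum_cong')
    fix f assume f: "f \<in> carrier F"
    then show "p \<otimes> l f \<otimes> u f = l f \<otimes> act f p \<otimes> u f" using p funcset_mem[OF l, of f] L_comm[of p "l f"] by auto
  qed (use lR pR in \<open>auto simp: Pi_def\<close>)
  also have "\<dots> = x \<otimes> p" unfolding xl using lincomb_mult_right[OF lR _ pR] by simp
  finally show ?thesis .
qed

text \<open>
  A central element commutes with each \<open>a \<in> L\<close>; comparing coefficients at \<open>f\<close> gives
  \<open>l f \<otimes> act f a = l f \<otimes> a\<close>. So a nonzero coefficient forces \<open>f\<close> to act trivially on \<open>L\<close>, and by
  faithfulness only the coefficient at the identity is left.
\<close>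

lemma center_eq_fixed: "ring_center R = fixed"
proof (intro equalityI subsetI)
  fix z assume "z \<in> fixed"
  then show "z \<in> ring_center R" using fixed_central unfolding ring_center_def by auto
next
  fix z assume "z \<in> ring_center R"
  then have z: "z \<in> carrier R" and central: "\<And>x. x \<in> carrier R \<Longrightarrow> z \<otimes> x = x \<otimes> z"
    unfolding ring_center_def by auto
  obtain l where l: "l \<in> carrier F \<rightarrow> L" and zl: "z = lincomb l (carrier F)"
    using z spanning unfolding combs_def by blast
  have lR: "l \<in> carrier F \<rightarrow> carrier R" using l by (rule coeffs_carrier)
  have l_zero: "l f = \<zero>" if f: "f \<in> carrier F" and ne: "f \<noteq> \<one>\<^bsub>F\<^esub>" for f
  proof (rule ccontr)
    assume lf: "l f \<noteq> \<zero>"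
    have lfL: "l f \<in> L" using l f by blast
    have "act f a = act \<one>\<^bsub>F\<^esub> a" if a: "a \<in> L" for a
    proof -
      have aR: "a \<in> carrier R" using a by simp
      have "lincomb (\<lambda>f. l f \<otimes> act f a) (carrier F) = lincomb (\<lambda>f. a \<otimes> l f) (carrier F)"
        using central[OF aR] lincomb_smult[OF lR _ aR] lincomb_mult_right[OF lR _ aR] zl by simp
      then have "l f \<otimes> act f a = a \<otimes> l f"
        by (rule lincomb_unique[rotated 2]) (use l a f L_closed(6) in \<open>auto simp: Pi_def\<close>)
      then have "l f \<otimes> act f a = l f \<otimes> a" using L_comm[OF a lfL] by simp
      moreover have "l f \<in> Units R" using lf lfL division by simp
      ultimately show ?thesis using a f by (simp add: conj_one)
    qed
    then have "f = \<one>\<^bsub>F\<^esub>" using faithful[of f "\<one>\<^bsub>F\<^esub>"] f unfolding act_def by blast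
    then show False using ne by blast
  qed
  have "z = l \<one>\<^bsub>F\<^esub> \<otimes> u \<one>\<^bsub>F\<^esub> \<oplus> lincomb l (carrier F - {\<one>\<^bsub>F\<^esub>})"
    using lincomb_insert[of "carrier F - {\<one>\<^bsub>F\<^esub>}" "\<one>\<^bsub>F\<^esub>" l] finite_F lR zl
    by (simp add: insert_absorb)
  moreover have "lincomb l (carrier F - {\<one>\<^bsub>F\<^esub>}) = \<zero>"
    unfolding lincomb_def using l_zero by (intro add.finprod_one_eqI) auto
  moreover have l1: "l \<one>\<^bsub>F\<^esub> \<in> L" using l by auto
  ultimately have "z = l \<one>\<^bsub>F\<^esub>" by (simp add: u_one)
  then have zL: "z \<in> L" using l1 by simp
  moreover have "act f z = z" if f: "f \<in> carrier F" for f
    unfolding act_def using central[of "u f"] f z by (metis Units_r_inv Units_inv_closed m_assoc r_one u_carrier u_unit)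
  ultimately show "z \<in> fixed" by blast
qed

lemma fixed_subfield: "subfield fixed R"
proof (rule subfield_of_division_ringI[OF division one_not_zero])
  show "inv p \<in> fixed" if p: "p \<in> fixed - {\<zero>}" for p
  proof -
    have pL: "p \<in> L - {\<zero>}" using p by blast
    have iL: "inv p \<in> L" using subfield_m_inv(1)[OF subfield pL] by blast
    moreover have "act f (inv p) = inv p" if f: "f \<in> carrier F" for f
    proof -
      have "p \<otimes> act f (inv p) = act f p \<otimes> act f (inv p)" using p f by simp
      also have "\<dots> = act f (p \<otimes> inv p)" using conj_mult[OF f, of p "inv p"] pL iL by simp
      also have "\<dots> = p \<otimes> inv p"
        using subfield_m_inv(2)[OF subfield pL] f unfolding act_def by simp
      finally have "p \<otimes> act f (inv p) = p \<otimes> inv p" .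
      moreover have "p \<in> Units R" using pL division by simp
      ultimately show ?thesis using iL f Units_l_cancel[of p "act f (inv p)" "inv p"] by simp
    qed
    ultimately show ?thesis by blast
  qed
  show "subring fixed R"
  proof (rule subringI)
    show "\<one> \<in> fixed" using L_closed(3) unfolding act_def by simp
    show "fixed \<subseteq> carrier R" by auto
    fix p q assume pq: "p \<in> fixed" "q \<in> fixed"
    show "\<ominus> p \<in> fixed" using pq L_closed(5) unfolding act_def by (auto simp: r_minus l_minus)
    show "p \<otimes> q \<in> fixed" using pq L_closed(6) by (auto simp: conj_mult)
    show "p \<oplus> q \<in> fixed" using pq L_closed(7) by (auto simp: conj_add)
  qed
  show "p \<otimes> q = q \<otimes> p" if "p \<in> fixed" "q \<in> fixed" for p q using that L_comm by blast
qed

text \<open>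
  Right multiplication of this element by \<open>a \<in> L\<close> lists all conjugates of \<open>a\<close> as coefficients
  (\<open>unit_sum_mult\<close>). This replaces the vector of conjugates in the classical proof of Artin's
  theorem.
\<close>

definition unit_sum where "unit_sum = lincomb (\<lambda>f. \<one>) (carrier F)"

lemma unit_sum_carrier: "unit_sum \<in> carrier R"
  unfolding unit_sum_def by (rule lincomb_carrier) auto

lemma unit_sum_nonzero: "unit_sum \<noteq> \<zero>"
  using lincomb_eq_zero[of "\<lambda>f. \<one>" "\<one>\<^bsub>F\<^esub>"] one_not_zero L_closed(3) unfolding unit_sum_def by auto

lemma unit_sum_mult: "a \<in> L \<Longrightarrow> unit_sum \<otimes> a = lincomb (\<lambda>f. act f a) (carrier F)"
proof -
  assume a: "a \<in> L"
  have "unit_sum \<otimes> a = lincomb (\<lambda>f. \<one> \<otimes> act f a) (carrier F)"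
    unfolding unit_sum_def by (rule lincomb_mult_right) (use a in auto)
  also have "\<dots> = lincomb (\<lambda>f. act f a) (carrier F)"
    unfolding lincomb_def using a by (intro finsum_cong') auto
  finally show ?thesis .
qed

text \<open>
  Choose a longest list in \<open>L\<close> whose products with \<open>unit_sum\<close> are independent. By maximality the span
  \<open>W\<close> contains \<open>unit_sum \<otimes> a\<close> for all \<open>a \<in> L\<close>, hence is closed under right multiplication by \<open>L\<close>.
  So it is a bimodule that contains \<open>unit_sum\<close>, and by elimination every \<open>u f\<close>.
\<close>

lemma unit_sum_basis_exists:
  obtains as where "set as \<subseteq> L" and "length as = card (carrier F)"
    and "independent L (map (\<lambda>a. unit_sum \<otimes> a) as)"
    and "Span L (map (\<lambda>a. unit_sum \<otimes> a) as) = carrier R"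
proof -
  define P where "P as \<longleftrightarrow> set as \<subseteq> L \<and> independent L (map (\<lambda>a. unit_sum \<otimes> a) as)" for as
  have vR: "set (map (\<lambda>a. unit_sum \<otimes> a) as) \<subseteq> carrier R" if "set as \<subseteq> L" for as
    using that unit_sum_carrier by auto
  have bound: "length as \<le> card (carrier F)" if "P as" for as
    using independent_length_le_dimension[OF subfield dimension_over_L, of "map (\<lambda>a. unit_sum \<otimes> a) as"]
      that vR unfolding P_def by simp
  have "P []" unfolding P_def by simp
  then obtain as where as: "P as" and max: "\<And>bs. P bs \<Longrightarrow> length bs \<le> length as"
  proof -
    have "\<forall>as. P as \<longrightarrow> length as < Suc (card (carrier F))" using bound by (simp add: less_Suc_eq_le)
    then show thesis using ex_has_greatest_nat[of P "[]" length] \<open>P []\<close> that by metis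
  qed
  have asL: "set as \<subseteq> L" and indep: "independent L (map (\<lambda>a. unit_sum \<otimes> a) as)"
    using as unfolding P_def by auto
  define W where "W = Span L (map (\<lambda>a. unit_sum \<otimes> a) as)"
  have W_alg: "subalgebra L W R" unfolding W_def by (rule Span_is_subalgebra[OF subfield vR[OF asL]])
  then have W: "subgroup W (add_monoid R)" unfolding subalgebra_def by blast
  have W_carrier: "W \<subseteq> carrier R" using subalgebra_in_carrier[OF W_alg] .
  have W_left: "p \<otimes> w \<in> W" if "p \<in> L" "w \<in> W" for p w
    using subalgebra.smult_closed[OF W_alg] that by blast
  have W_gen: "unit_sum \<otimes> a \<in> W" if a: "a \<in> L" for a
  proof (rule ccontr)
    assume "unit_sum \<otimes> a \<notin> W"
    then have "P (a # as)" unfolding P_def W_def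
      using asL indep a unit_sum_carrier by (auto intro: li_Cons)
    then show False using max by fastforce
  qed
  have W_right: "w \<otimes> p \<in> W" if p: "p \<in> L" and w: "w \<in> W" for p w
  proof -
    obtain Ks where Ks: "set Ks \<subseteq> L" "w = combine Ks (map (\<lambda>a. unit_sum \<otimes> a) as)"
      using w Span_mem_iff_length_version[OF subfield vR[OF asL]] unfolding W_def by blast
    have KsR: "set Ks \<subseteq> carrier R" and pR: "p \<in> carrier R" using Ks(1) p by auto
    have "w \<otimes> p = combine Ks (map (\<lambda>v. v \<otimes> p) (map (\<lambda>a. unit_sum \<otimes> a) as))"
      unfolding Ks(2) by (rule combine_l_distr[OF KsR vR[OF asL] pR])
    also have "map (\<lambda>v. v \<otimes> p) (map (\<lambda>a. unit_sum \<otimes> a) as) = map (\<lambda>a. unit_sum \<otimes> (a \<otimes> p)) as"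
      using asL p unit_sum_carrier by (auto simp: m_assoc subset_iff)
    also have "combine Ks (map (\<lambda>a. unit_sum \<otimes> (a \<otimes> p)) as) \<in> W"
      using Ks(1) asL
    proof (induction Ks "map (\<lambda>a. unit_sum \<otimes> (a \<otimes> p)) as" arbitrary: as rule: combine.induct)
      case (1 k Ks v Us)
      then obtain a bs where "as = a # bs" by (cases as) auto
      then show ?case
        using 1 W_left[of k] W_gen L_closed(6) p add.subgroupE(4)[OF W] by auto
    qed (use add.subgroupE(2) subgroup.one_closed[OF W] in auto)
    finally show ?thesis .
  qed
  have "u f \<in> W" if f: "f \<in> carrier F" for f
  proof -
    have "lincomb (\<lambda>f. \<one>) (carrier F) \<in> W"
      using W_gen[OF L_closed(3)] unit_sum_carrier unfolding unit_sum_def by simp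
    then have "\<one> \<otimes> u f \<in> W"
      using term_in_sub_bimodule[OF W W_left W_right, of "carrier F" "\<lambda>f. \<one>" f] f L_closed(3) by auto
    then show ?thesis using f by simp
  qed
  moreover obtain fs where fs: "distinct fs" "set fs = carrier F" by (rule enumeration_exists)
  ultimately have "Span L (map u fs) \<subseteq> W"
    by (intro subalgebra_Span_incl[OF subfield W_alg]) auto
  then have WR: "W = carrier R" using Span_u[OF fs] spanning W_carrier by blast
  have "dimension (length as) L (carrier R)"
    using dimensionI[OF subfield indep] WR unfolding W_def by simp
  then have "length as = card (carrier F)"
    using dimension_is_inj[OF subfield _ dimension_over_L] by blast
  then show thesis using that asL indep WR unfolding W_def by blast
qed

lemma combine_unit_sum:
  assumes "set Ks \<subseteq> L" "set as \<subseteq> L"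
  shows "combine Ks (map (\<lambda>a. unit_sum \<otimes> a) as) = lincomb (\<lambda>f. combine Ks (map (act f) as)) (carrier F)"
  using assms
proof (induction Ks as rule: list_induct2')
  case (4 k Ks a as)
  have c: "(\<lambda>f. combine Ks (map (act f) as)) \<in> carrier F \<rightarrow> carrier R"
    using 4 by (auto intro!: combine_in_carrier simp: subset_iff)
  have "k \<otimes> (unit_sum \<otimes> a) = lincomb (\<lambda>f. k \<otimes> act f a) (carrier F)"
    using 4 unit_sum_mult[of a] lincomb_smult[of "\<lambda>f. act f a" "carrier F" k] by auto
  then show ?case
    using 4 c lincomb_add[of "\<lambda>f. k \<otimes> act f a" "carrier F" "\<lambda>f. combine Ks (map (act f) as)"]
    by auto
qed (auto simp: lincomb_def intro!: add.finprod_one_eqI[symmetric])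

lemma combine_in_L: "set Ks \<subseteq> L \<Longrightarrow> set as \<subseteq> L \<Longrightarrow> combine Ks as \<in> L"
  using L_closed(2,6,7) by (induction Ks as rule: list_induct2') auto

lemma act_combine:
  assumes "g \<in> carrier F" "set Ks \<subseteq> L" "set as \<subseteq> L"
  shows "act g (combine Ks as) = combine (map (act g) Ks) (map (act g) as)"
  using assms(2,3)
proof (induction Ks as rule: list_induct2')
  case (4 k Ks a as)
  have "combine Ks as \<in> carrier R" using 4 by (intro combine_in_carrier) auto
  then show ?case using 4 assms(1) by (auto simp: conj_add conj_mult)
qed (simp_all add: conj_zero assms(1))

text \<open>
  The elements \<open>as\<close> of \<open>unit_sum_basis_exists\<close> form a basis. A relation with central coefficients can
  be multiplied by \<open>unit_sum\<close> on the left, which gives independence. For \<open>a \<in> L\<close> let \<open>Ks\<close> be the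
  coordinates of \<open>unit_sum \<otimes> a\<close>; that is, \<open>act f a = combine Ks (map (act f) as)\<close> for all \<open>f\<close>.
  Applying \<open>act g\<close> permutes these equations and replaces \<open>Ks\<close> by its image. As the coordinates are
  unique, they are fixed, and \<open>unit_sum\<close> can be cancelled.
\<close>

lemma dimension_over_fixed: "dimension (card (carrier F)) fixed L"
proof -
  obtain as where asL: "set as \<subseteq> L" and len: "length as = card (carrier F)"
    and indep: "independent L (map (\<lambda>a. unit_sum \<otimes> a) as)"
    and span: "Span L (map (\<lambda>a. unit_sum \<otimes> a) as) = carrier R"
    by (rule unit_sum_basis_exists)
  have asR: "set as \<subseteq> carrier R" using asL by auto
  have vR: "set (map (\<lambda>a. unit_sum \<otimes> a) as) \<subseteq> carrier R" using asR unit_sum_carrier by auto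
  have unit_sum_combine: "unit_sum \<otimes> combine Ks as = combine Ks (map (\<lambda>a. unit_sum \<otimes> a) as)"
    if "set Ks \<subseteq> fixed" for Ks
    using that asR
  proof (induction Ks as rule: list_induct2')
    case (4 k Ks a as)
    have "combine Ks as \<in> carrier R" using 4 by (intro combine_in_carrier) auto
    moreover have "unit_sum \<otimes> (k \<otimes> a) = k \<otimes> (unit_sum \<otimes> a)"
      using 4 unit_sum_carrier fixed_central[of k unit_sum] by (simp add: m_assoc[symmetric])
    ultimately show ?case using 4 unit_sum_carrier by (auto simp: r_distr)
  qed (simp_all add: unit_sum_carrier)
  have "independent fixed as"
  proof (rule trivial_combine_imp_independent[OF fixed_subfield asR])
    fix Ks assume Ks: "set Ks \<subseteq> fixed" "combine Ks as = \<zero>"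
    have "combine Ks (map (\<lambda>a. unit_sum \<otimes> a) as) = \<zero>"
      using unit_sum_combine[OF Ks(1)] Ks(2) unit_sum_carrier by simp
    then show "set (take (length as) Ks) \<subseteq> {\<zero>}"
      using independent_imp_trivial_combine[OF subfield indep, of Ks] Ks(1) by auto
  qed
  moreover have "Span fixed as = L"
  proof
    have "subalgebra fixed L R"
      using L_closed subring.axioms(1)[OF L_subring]
      by (auto simp: subalgebra_def subalgebra_axioms_def)
    then show "Span fixed as \<subseteq> L" using subalgebra_Span_incl[OF fixed_subfield _ asL] by blast
    show "L \<subseteq> Span fixed as"
    proof
      fix a assume a: "a \<in> L"
      have "unit_sum \<otimes> a \<in> Span L (map (\<lambda>a. unit_sum \<otimes> a) as)" using a unit_sum_carrier span by simp
      then obtain Ks where Ks: "set Ks \<subseteq> L" "length Ks = length as"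
        and eq: "unit_sum \<otimes> a = combine Ks (map (\<lambda>a. unit_sum \<otimes> a) as)"
        and unique: "\<And>Ks'. set Ks' \<subseteq> L \<Longrightarrow> length Ks' = length as \<Longrightarrow>
          unit_sum \<otimes> a = combine Ks' (map (\<lambda>a. unit_sum \<otimes> a) as) \<Longrightarrow> Ks' = Ks"
        using unique_decomposition[OF subfield indep] by (metis (no_types, lifting) length_map)
      have acts: "set (map (act f) as) \<subseteq> L" if "f \<in> carrier F" for f using that asL by auto
      have coeff: "act f a = combine Ks (map (act f) as)" if f: "f \<in> carrier F" for f
      proof (rule lincomb_unique[OF _ _ _ f])
        show "lincomb (\<lambda>f. act f a) (carrier F) = lincomb (\<lambda>f. combine Ks (map (act f) as)) (carrier F)"
          using eq unit_sum_mult[OF a] combine_unit_sum[OF Ks(1) asL] by simp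
      qed (use a Ks(1) acts combine_in_L in auto)
      have "map (act g) Ks = Ks" if g: "g \<in> carrier F" for g
      proof (rule unique)
        show gKs: "set (map (act g) Ks) \<subseteq> L" using Ks(1) g by auto
        show "length (map (act g) Ks) = length as" using Ks(2) by simp
        have "act f a = combine (map (act g) Ks) (map (act f) as)" if f: "f \<in> carrier F" for f
        proof -
          \<comment> \<open>The equation at \<open>f\<close> for the new coefficients comes from the old one at \<open>h\<close>.\<close>
          define h where "h = inv\<^bsub>F\<^esub> g \<otimes>\<^bsub>F\<^esub> f"
          have h: "h \<in> carrier F" and gh: "g \<otimes>\<^bsub>F\<^esub> h = f"
            unfolding h_def using f g by (simp_all add: F.m_assoc[symmetric])
          have "act f a = act g (combine Ks (map (act h) as))"
            using conj_comp[OF g h a] gh coeff[OF h] by simp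
          also have "\<dots> = combine (map (act g) Ks) (map (act g) (map (act h) as))"
            by (rule act_combine[OF g Ks(1) acts[OF h]])
          also have "map (act g) (map (act h) as) = map (act f) as"
            using conj_comp[OF g h] gh asL by auto
          finally show ?thesis .
        qed
        then have "lincomb (\<lambda>f. act f a) (carrier F) =
            lincomb (\<lambda>f. combine (map (act g) Ks) (map (act f) as)) (carrier F)"
          unfolding lincomb_def
          by (intro finsum_cong') (use combine_in_L[OF gKs acts] in auto)
        then show "unit_sum \<otimes> a = combine (map (act g) Ks) (map (\<lambda>a. unit_sum \<otimes> a) as)"
          using unit_sum_mult[OF a] combine_unit_sum[OF gKs asL] by simp
      qed
      then have "act g x = x" if "g \<in> carrier F" "x \<in> set Ks" for g x
        using that map_eq_conv[of "act g" Ks id] by simp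
      then have Ks_fixed: "set Ks \<subseteq> fixed" using Ks(1) by blast
      have "unit_sum \<otimes> a = unit_sum \<otimes> combine Ks as" using eq unit_sum_combine[OF Ks_fixed] by simp
      moreover have "unit_sum \<in> Units R" using unit_sum_carrier unit_sum_nonzero division by simp
      ultimately have "a = combine Ks as" using a Ks(1) asR by (simp add: combine_in_L asL)
      then show "a \<in> Span fixed as"
        using Span_mem_iff_length_version[OF fixed_subfield asR] Ks_fixed Ks(2) by blast
    qed
  qed
  ultimately show ?thesis unfolding len[symmetric] by (rule dimensionI[OF fixed_subfield])
qed

lemma dimension_over_center: "dimension ((card (carrier F))\<^sup>2) (ring_center R) (carrier R)"
  using telescopic_base[OF fixed_subfield subfield dimension_over_fixed dimension_over_L]
  unfolding center_eq_fixed power2_eq_square .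

lemma crossed_product: "crossed_product R L F u act cocycle"
proof -
  have uniq: "\<exists>!l. l \<in> carrier F \<rightarrow>\<^sub>E L \<and> x = (\<Oplus>f\<in>carrier F. l f \<otimes> u f)"
    if x: "x \<in> carrier R" for x
  proof -
    obtain l where l: "l \<in> carrier F \<rightarrow> L" and xl: "x = lincomb l (carrier F)"
      using x spanning unfolding combs_def by blast
    show ?thesis
    proof (rule ex1I[of _ "restrict l (carrier F)"])
      have "x = (\<Oplus>f\<in>carrier F. restrict l (carrier F) f \<otimes> u f)"
        unfolding xl lincomb_def using l by (intro finsum_cong') (auto simp: Pi_def)
      then show "restrict l (carrier F) \<in> carrier F \<rightarrow>\<^sub>E L \<and>
          x = (\<Oplus>f\<in>carrier F. restrict l (carrier F) f \<otimes> u f)" using l by auto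
      fix m assume m: "m \<in> carrier F \<rightarrow>\<^sub>E L \<and> x = (\<Oplus>f\<in>carrier F. m f \<otimes> u f)"
      then have mL: "m \<in> carrier F \<rightarrow> L" and eq: "lincomb m (carrier F) = lincomb l (carrier F)"
        unfolding lincomb_def[of m] xl[symmetric] by auto
      have "m f = l f" if "f \<in> carrier F" for f
        by (rule lincomb_unique[OF mL l eq that])
      then show "m = restrict l (carrier F)" using m by (intro PiE_ext[of m "carrier F" "\<lambda>_. L"]) (use l in auto)
    qed
  qed
  have add: "(\<Oplus>f\<in>carrier F. l f \<otimes> u f) \<oplus> (\<Oplus>f\<in>carrier F. m f \<otimes> u f) =
      (\<Oplus>f\<in>carrier F. (l f \<oplus> m f) \<otimes> u f)"
    if "l \<in> carrier F \<rightarrow> L" "m \<in> carrier F \<rightarrow> L" for l m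
    using lincomb_add[OF coeffs_carrier[OF that(1)] coeffs_carrier[OF that(2)]]
    unfolding lincomb_def by simp
  show ?thesis unfolding crossed_product_def
  proof (intro conjI ballI)
    fix x assume "x \<in> carrier R"
    then show "\<exists>!l. l \<in> carrier F \<rightarrow>\<^sub>E L \<and> x = (\<Oplus>f\<in>carrier F. l f \<otimes> u f)" by (rule uniq)
  next
    fix l m assume "l \<in> carrier F \<rightarrow> L" "m \<in> carrier F \<rightarrow> L"
    then show "(\<Oplus>f\<in>carrier F. l f \<otimes> u f) \<oplus> (\<Oplus>f\<in>carrier F. m f \<otimes> u f) =
      (\<Oplus>f\<in>carrier F. (l f \<oplus> m f) \<otimes> u f)" by (rule add)
  next
    fix f g r assume "f \<in> carrier F" "g \<in> carrier F" "r \<in> L"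
    then show "cocycle f g \<otimes> act (f \<otimes>\<^bsub>F\<^esub> g) r = act f (act g r) \<otimes> cocycle f g"
      by (simp add: conj_cocycle)
  qed (simp_all add: ring_axioms F.group_axioms subfield finite_F conj_ring_iso cocycle_nonzero
      cocycle_identity term_mult conj_one cocycle_one)
qed

end

section \<open>Group rings embedded in a division ring\<close>

text \<open>
  Computations with elements of the group ring are carried out in \<open>Q\<close>. The only products of
  functions that have to be evaluated are those whose left factor is a monomial; everything else
  follows by adding up monomials.
\<close>

locale embedded_group_ring = ring Q + G: group G + K: field K
  for Q (structure) and G :: "('g, 'n) monoid_scheme" and K :: "('k, 'm) ring_scheme" +
  fixes \<iota> :: "('g \<Rightarrow> 'k) \<Rightarrow> 'a"
  assumes division_Q: "division_ring Q"
    and \<iota>_hom: "\<iota> \<in> ring_hom (group_ring K G) Q"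
    and \<iota>_inj: "inj_on \<iota> (carrier (group_ring K G))"
begin

abbreviation KG where "KG \<equiv> group_ring K G"
abbreviation supported where "supported M \<equiv> sub_group_ring K G M"

definition monomial :: "'k \<Rightarrow> 'g \<Rightarrow> 'g \<Rightarrow> 'k" where
  "monomial c h = (\<lambda>g. if g = h then c else \<zero>\<^bsub>K\<^esub>)"
definition img_monomial where "img_monomial c h = \<iota> (monomial c h)"
definition img_ring where "img_ring M = \<iota> ` supported M"

lemma division: "Units Q = carrier Q - {\<zero>}" and one_not_zero: "\<one> \<noteq> \<zero>"
  using division_Q unfolding division_ring_def by auto

lemma group_ring_elt_eq: "group_ring_elt K = monomial \<one>\<^bsub>K\<^esub>"
  unfolding group_ring_elt_def monomial_def by auto

lemma mem_supported_iff:
  assumes "M \<subseteq> carrier G"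
  shows "a \<in> supported M \<longleftrightarrow> (\<forall>g. a g \<in> carrier K) \<and> (\<forall>g. g \<notin> M \<longrightarrow> a g = \<zero>\<^bsub>K\<^esub>) \<and> finite {g. a g \<noteq> \<zero>\<^bsub>K\<^esub>}"
  unfolding sub_group_ring_def group_ring_def using assms
  by (auto; metis K.zero_closed subsetD)

lemma supported_carrier: "supported (carrier G) = carrier KG"
  unfolding sub_group_ring_def group_ring_def by auto

lemma supported_subset: "supported M \<subseteq> carrier KG"
  unfolding sub_group_ring_def by auto

lemma KG_add: "(a \<oplus>\<^bsub>KG\<^esub> b) = (\<lambda>g. a g \<oplus>\<^bsub>K\<^esub> b g)" and KG_zero: "\<zero>\<^bsub>KG\<^esub> = (\<lambda>g. \<zero>\<^bsub>K\<^esub>)"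
  and KG_one: "\<one>\<^bsub>KG\<^esub> = monomial \<one>\<^bsub>K\<^esub> \<one>\<^bsub>G\<^esub>"
  unfolding group_ring_def monomial_def by simp_all

lemma monomial_in_supported:
  assumes "M \<subseteq> carrier G" "c \<in> carrier K" "h \<in> M" shows "monomial c h \<in> supported M"
proof -
  have "{g. monomial c h g \<noteq> \<zero>\<^bsub>K\<^esub>} \<subseteq> {h}" unfolding monomial_def by auto
  then have "finite {g. monomial c h g \<noteq> \<zero>\<^bsub>K\<^esub>}" using finite_subset by blast
  then show ?thesis unfolding mem_supported_iff[OF assms(1)] using assms(2,3) by (auto simp: monomial_def)
qed

lemma zero_in_supported: "M \<subseteq> carrier G \<Longrightarrow> \<zero>\<^bsub>KG\<^esub> \<in> supported M"
  by (simp add: mem_supported_iff KG_zero)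

lemma add_in_supported:
  assumes M: "M \<subseteq> carrier G" and "a \<in> supported M" "b \<in> supported M" shows "a \<oplus>\<^bsub>KG\<^esub> b \<in> supported M"
proof -
  have "{g. a g \<oplus>\<^bsub>K\<^esub> b g \<noteq> \<zero>\<^bsub>K\<^esub>} \<subseteq> {g. a g \<noteq> \<zero>\<^bsub>K\<^esub>} \<union> {g. b g \<noteq> \<zero>\<^bsub>K\<^esub>}" by auto
  moreover have "finite ({g. a g \<noteq> \<zero>\<^bsub>K\<^esub>} \<union> {g. b g \<noteq> \<zero>\<^bsub>K\<^esub>})" using assms mem_supported_iff[OF M] by blast
  ultimately have "finite {g. a g \<oplus>\<^bsub>K\<^esub> b g \<noteq> \<zero>\<^bsub>K\<^esub>}" using finite_subset by blast
  then show ?thesis using assms(2,3) unfolding mem_supported_iff[OF M] KG_add by auto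
qed

text \<open>
  Induction on the size of the support, splitting off one monomial.
\<close>

lemma supported_induct [consumes 2, case_names zero mono]:
  assumes M: "M \<subseteq> carrier G" and "a \<in> supported M" and zero: "P \<zero>\<^bsub>KG\<^esub>"
    and step: "\<And>c h a. c \<in> carrier K \<Longrightarrow> h \<in> M \<Longrightarrow> a \<in> supported M \<Longrightarrow> P a \<Longrightarrow> P (monomial c h \<oplus>\<^bsub>KG\<^esub> a)"
  shows "P a"
  using assms(2)
proof (induction "card {g. a g \<noteq> \<zero>\<^bsub>K\<^esub>}" arbitrary: a)
  case 0
  then have "{g. a g \<noteq> \<zero>\<^bsub>K\<^esub>} = {}" unfolding mem_supported_iff[OF M] by simp
  then have "a = \<zero>\<^bsub>KG\<^esub>" unfolding KG_zero by auto
  then show ?case using zero by simp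
next
  case (Suc n)
  then have "{g. a g \<noteq> \<zero>\<^bsub>K\<^esub>} \<noteq> {}" by (metis card.empty nat.distinct(1))
  then obtain h where h: "a h \<noteq> \<zero>\<^bsub>K\<^esub>" by blast
  have a: "\<And>g. a g \<in> carrier K" "\<And>g. g \<notin> M \<Longrightarrow> a g = \<zero>\<^bsub>K\<^esub>" "finite {g. a g \<noteq> \<zero>\<^bsub>K\<^esub>}"
    using Suc.prems unfolding mem_supported_iff[OF M] by auto
  define b where "b = a(h := \<zero>\<^bsub>K\<^esub>)"
  have supp: "{g. b g \<noteq> \<zero>\<^bsub>K\<^esub>} = {g. a g \<noteq> \<zero>\<^bsub>K\<^esub>} - {h}" unfolding b_def by auto
  have b: "b \<in> supported M" unfolding mem_supported_iff[OF M] supp using a by (auto simp: b_def)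
  moreover have "n = card {g. b g \<noteq> \<zero>\<^bsub>K\<^esub>}"
    unfolding supp using Suc.hyps(2) a(3) h by simp
  ultimately have "P b" using Suc.hyps(1) by blast
  moreover have "a = monomial (a h) h \<oplus>\<^bsub>KG\<^esub> b"
    unfolding KG_add b_def monomial_def using a(1) by auto
  ultimately show ?case using step[OF a(1) _ b, of h h] a(2) h by metis
qed

text \<open>
  The sum that defines the convolution ranges over the support of the left factor, which is \<open>{h}\<close>, or
  empty if \<open>c\<close> is zero.
\<close>

lemma monomial_mult:
  assumes c: "c \<in> carrier K" and h: "h \<in> carrier G" and b: "b \<in> carrier KG"
  shows "monomial c h \<otimes>\<^bsub>KG\<^esub> b =
    (\<lambda>g. if g \<in> carrier G then c \<otimes>\<^bsub>K\<^esub> b (inv\<^bsub>G\<^esub> h \<otimes>\<^bsub>G\<^esub> g) else \<zero>\<^bsub>K\<^esub>)"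
proof -
  have bK: "b g \<in> carrier K" for g using b mem_supported_iff[of "carrier G" b] supported_carrier by blast
  have "(\<Oplus>\<^bsub>K\<^esub>x\<in>{x \<in> carrier G. monomial c h x \<noteq> \<zero>\<^bsub>K\<^esub>}. monomial c h x \<otimes>\<^bsub>K\<^esub> b (inv\<^bsub>G\<^esub> x \<otimes>\<^bsub>G\<^esub> g)) =
      c \<otimes>\<^bsub>K\<^esub> b (inv\<^bsub>G\<^esub> h \<otimes>\<^bsub>G\<^esub> g)" for g
  proof (cases "c = \<zero>\<^bsub>K\<^esub>")
    case True
    then have empty: "{x \<in> carrier G. monomial c h x \<noteq> \<zero>\<^bsub>K\<^esub>} = {}" unfolding monomial_def by auto
    show ?thesis unfolding empty using True bK by simp
  next
    case False
    then have single: "{x \<in> carrier G. monomial c h x \<noteq> \<zero>\<^bsub>K\<^esub>} = {h}" unfolding monomial_def using h by auto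
    show ?thesis unfolding single using c bK by (simp add: monomial_def)
  qed
  then show ?thesis unfolding group_ring_def by auto
qed

lemma monomial_mult_monomial:
  assumes "c \<in> carrier K" "h \<in> carrier G" "d \<in> carrier K" "g \<in> carrier G"
  shows "monomial c h \<otimes>\<^bsub>KG\<^esub> monomial d g = monomial (c \<otimes>\<^bsub>K\<^esub> d) (h \<otimes>\<^bsub>G\<^esub> g)"
proof -
  have "monomial d g \<in> carrier KG" using monomial_in_supported[of "carrier G" d g] supported_carrier assms by blast
  then show ?thesis
    using assms G.inv_solve_left'[of g h] by (subst monomial_mult) (auto simp: monomial_def fun_eq_iff)
qed

lemma \<iota>_add: "a \<in> carrier KG \<Longrightarrow> b \<in> carrier KG \<Longrightarrow> \<iota> (a \<oplus>\<^bsub>KG\<^esub> b) = \<iota> a \<oplus> \<iota> b"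
  and \<iota>_mult: "a \<in> carrier KG \<Longrightarrow> b \<in> carrier KG \<Longrightarrow> \<iota> (a \<otimes>\<^bsub>KG\<^esub> b) = \<iota> a \<otimes> \<iota> b"
  and \<iota>_carrier: "a \<in> carrier KG \<Longrightarrow> \<iota> a \<in> carrier Q"
  and \<iota>_one: "\<iota> \<one>\<^bsub>KG\<^esub> = \<one>"
  using \<iota>_hom unfolding ring_hom_def by auto

lemma \<iota>_zero: "\<iota> \<zero>\<^bsub>KG\<^esub> = \<zero>"
proof -
  have z: "\<zero>\<^bsub>KG\<^esub> \<in> carrier KG" using zero_in_supported[of "carrier G"] supported_carrier by blast
  have "\<iota> \<zero>\<^bsub>KG\<^esub> \<oplus> \<iota> \<zero>\<^bsub>KG\<^esub> = \<iota> \<zero>\<^bsub>KG\<^esub>"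
    unfolding \<iota>_add[OF z z, symmetric] by (simp add: KG_add KG_zero)
  then show ?thesis using \<iota>_carrier[OF z] by (metis add.r_cancel_one')
qed

lemma \<iota>_nonzero: "a \<in> carrier KG \<Longrightarrow> a \<noteq> \<zero>\<^bsub>KG\<^esub> \<Longrightarrow> \<iota> a \<noteq> \<zero>"
  using \<iota>_inj \<iota>_zero zero_in_supported[of "carrier G"] supported_carrier unfolding inj_on_def by (metis order_refl)

lemma img_ring_carrier: "img_ring M \<subseteq> carrier Q"
  unfolding img_ring_def using supported_subset \<iota>_carrier by blast

lemma img_monomial_in_img_ring: "M \<subseteq> carrier G \<Longrightarrow> c \<in> carrier K \<Longrightarrow> h \<in> M \<Longrightarrow> img_monomial c h \<in> img_ring M"
  unfolding img_ring_def img_monomial_def using monomial_in_supported by blast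

lemma img_monomial_carrier [simp]: "c \<in> carrier K \<Longrightarrow> h \<in> carrier G \<Longrightarrow> img_monomial c h \<in> carrier Q"
  using img_monomial_in_img_ring[of "carrier G"] img_ring_carrier by blast

lemma img_monomial_mult:
  assumes "c \<in> carrier K" "h \<in> carrier G" "d \<in> carrier K" "g \<in> carrier G"
  shows "img_monomial c h \<otimes> img_monomial d g = img_monomial (c \<otimes>\<^bsub>K\<^esub> d) (h \<otimes>\<^bsub>G\<^esub> g)"
  unfolding img_monomial_def monomial_mult_monomial[OF assms, symmetric]
  using monomial_in_supported[of "carrier G"] supported_carrier assms by (intro \<iota>_mult[symmetric]) auto

lemma img_monomial_one: "img_monomial \<one>\<^bsub>K\<^esub> \<one>\<^bsub>G\<^esub> = \<one>"
  unfolding img_monomial_def KG_one[symmetric] by (rule \<iota>_one)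

lemma img_monomial_unit:
  assumes "h \<in> carrier G"
  shows "img_monomial \<one>\<^bsub>K\<^esub> h \<in> Units Q" and "inv (img_monomial \<one>\<^bsub>K\<^esub> h) = img_monomial \<one>\<^bsub>K\<^esub> (inv\<^bsub>G\<^esub> h)"
proof -
  have *: "img_monomial \<one>\<^bsub>K\<^esub> h \<otimes> img_monomial \<one>\<^bsub>K\<^esub> (inv\<^bsub>G\<^esub> h) = \<one>" "img_monomial \<one>\<^bsub>K\<^esub> (inv\<^bsub>G\<^esub> h) \<otimes> img_monomial \<one>\<^bsub>K\<^esub> h = \<one>"
    using assms by (simp_all add: img_monomial_mult img_monomial_one)
  then show U: "img_monomial \<one>\<^bsub>K\<^esub> h \<in> Units Q"
    unfolding Units_def using assms by (auto intro!: bexI[of _ "img_monomial \<one>\<^bsub>K\<^esub> (inv\<^bsub>G\<^esub> h)"])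
  show "inv (img_monomial \<one>\<^bsub>K\<^esub> h) = img_monomial \<one>\<^bsub>K\<^esub> (inv\<^bsub>G\<^esub> h)"
    using inv_unique'[of "img_monomial \<one>\<^bsub>K\<^esub> h" "img_monomial \<one>\<^bsub>K\<^esub> (inv\<^bsub>G\<^esub> h)"] * assms by simp
qed

lemma img_monomial_one_inj:
  assumes "g \<in> carrier G" "h \<in> carrier G" "img_monomial \<one>\<^bsub>K\<^esub> g = img_monomial \<one>\<^bsub>K\<^esub> h" shows "g = h"
proof -
  have "monomial \<one>\<^bsub>K\<^esub> g \<in> carrier KG" "monomial \<one>\<^bsub>K\<^esub> h \<in> carrier KG"
    using monomial_in_supported[of "carrier G"] supported_carrier assms by auto
  then have "monomial \<one>\<^bsub>K\<^esub> g = monomial \<one>\<^bsub>K\<^esub> h" using \<iota>_inj assms(3) unfolding img_monomial_def inj_on_def by blast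
  then have "monomial \<one>\<^bsub>K\<^esub> g g = monomial \<one>\<^bsub>K\<^esub> h g" by simp
  then show ?thesis unfolding monomial_def by (simp split: if_splits)
qed

lemma img_ring_induct [consumes 2, case_names zero mono]:
  assumes M: "M \<subseteq> carrier G" and x: "x \<in> img_ring M" and zero: "P \<zero>"
    and step: "\<And>c h x. c \<in> carrier K \<Longrightarrow> h \<in> M \<Longrightarrow> x \<in> img_ring M \<Longrightarrow> P x \<Longrightarrow> P (img_monomial c h \<oplus> x)"
  shows "P x"
proof -
  obtain a where a: "a \<in> supported M" "x = \<iota> a" using x unfolding img_ring_def by blast
  have "P (\<iota> a)" using M a(1)
  proof (induction rule: supported_induct)
    case zero
    then show ?case using assms(3) by (simp add: \<iota>_zero)
  next
    case (mono c h a)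
    have "\<iota> (monomial c h \<oplus>\<^bsub>KG\<^esub> a) = img_monomial c h \<oplus> \<iota> a"
      unfolding img_monomial_def using mono(2,3,1) monomial_in_supported[OF M] supported_subset by (intro \<iota>_add) auto
    then show ?case using step[of c h "\<iota> a"] mono unfolding img_ring_def by auto
  qed
  then show ?thesis using a(2) by simp
qed

lemma img_ring_add:
  assumes M: "M \<subseteq> carrier G" and "x \<in> img_ring M" "y \<in> img_ring M" shows "x \<oplus> y \<in> img_ring M"
proof -
  obtain a b where ab: "a \<in> supported M" "b \<in> supported M" and xy: "x = \<iota> a" "y = \<iota> b"
    using assms(2,3) unfolding img_ring_def by blast
  have "x \<oplus> y = \<iota> (a \<oplus>\<^bsub>KG\<^esub> b)"
    unfolding xy by (rule \<iota>_add[symmetric]) (use ab supported_subset in auto)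
  then show ?thesis unfolding img_ring_def using add_in_supported[OF M ab] by simp
qed

lemma img_ring_zero: "M \<subseteq> carrier G \<Longrightarrow> \<zero> \<in> img_ring M"
  using imageI[OF zero_in_supported, of M \<iota>] unfolding img_ring_def \<iota>_zero .

lemma img_monomial_mult_img_ring:
  assumes M: "subgroup M G" and c: "c \<in> carrier K" and h: "h \<in> M" and x: "x \<in> img_ring M"
  shows "img_monomial c h \<otimes> x \<in> img_ring M"
proof -
  interpret M: subgroup M G by fact
  show ?thesis using M.subset x
  proof (induction rule: img_ring_induct)
    case zero
    then show ?case using c h img_ring_zero[OF M.subset] by simp
  next
    case (mono d g x)
    have "x \<in> carrier Q" using mono img_ring_carrier by blast
    then have "img_monomial c h \<otimes> (img_monomial d g \<oplus> x) = img_monomial (c \<otimes>\<^bsub>K\<^esub> d) (h \<otimes>\<^bsub>G\<^esub> g) \<oplus> img_monomial c h \<otimes> x"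
      using mono c h by (simp add: r_distr img_monomial_mult)
    then show ?case using img_ring_add[OF M.subset img_monomial_in_img_ring[OF M.subset]] mono c h by simp
  qed
qed

lemma img_ring_subring:
  assumes M: "subgroup M G" shows "subring (img_ring M) Q"
proof -
  interpret M: subgroup M G by fact
  have mult: "x \<otimes> y \<in> img_ring M" if x: "x \<in> img_ring M" and y: "y \<in> img_ring M" for x y
    using M.subset x
  proof (induction rule: img_ring_induct)
    case zero
    have "y \<in> carrier Q" using y img_ring_carrier by blast
    then show ?case using img_ring_zero[OF M.subset] by simp
  next
    case (mono c h x)
    have "x \<in> carrier Q" "y \<in> carrier Q" using mono y img_ring_carrier by auto
    then have "(img_monomial c h \<oplus> x) \<otimes> y = img_monomial c h \<otimes> y \<oplus> x \<otimes> y" using mono by (simp add: l_distr)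
    then show ?case using img_ring_add[OF M.subset img_monomial_mult_img_ring[OF M]] mono y by simp
  qed
  have one: "\<one> \<in> img_ring M" using img_monomial_in_img_ring[OF M.subset, of "\<one>\<^bsub>K\<^esub>" "\<one>\<^bsub>G\<^esub>"] img_monomial_one by simp
  have minus: "\<ominus> x \<in> img_ring M" if x: "x \<in> img_ring M" for x
  proof -
    have "img_monomial (\<ominus>\<^bsub>K\<^esub> \<one>\<^bsub>K\<^esub>) \<one>\<^bsub>G\<^esub> \<oplus> img_monomial \<one>\<^bsub>K\<^esub> \<one>\<^bsub>G\<^esub> = \<zero>"
    proof -
      have "monomial (\<ominus>\<^bsub>K\<^esub> \<one>\<^bsub>K\<^esub>) \<one>\<^bsub>G\<^esub> \<oplus>\<^bsub>KG\<^esub> monomial \<one>\<^bsub>K\<^esub> \<one>\<^bsub>G\<^esub> = \<zero>\<^bsub>KG\<^esub>"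
        unfolding KG_add KG_zero monomial_def by (auto simp: K.l_neg)
      then show ?thesis unfolding img_monomial_def
        using \<iota>_add[of "monomial (\<ominus>\<^bsub>K\<^esub> \<one>\<^bsub>K\<^esub>) \<one>\<^bsub>G\<^esub>" "monomial \<one>\<^bsub>K\<^esub> \<one>\<^bsub>G\<^esub>"] \<iota>_zero
          monomial_in_supported[of "carrier G"] supported_carrier by auto
    qed
    then have "img_monomial (\<ominus>\<^bsub>K\<^esub> \<one>\<^bsub>K\<^esub>) \<one>\<^bsub>G\<^esub> = \<ominus> \<one>" using img_monomial_one minus_equality by simp
    moreover have "x \<in> carrier Q" using x img_ring_carrier by blast
    ultimately have "\<ominus> x = img_monomial (\<ominus>\<^bsub>K\<^esub> \<one>\<^bsub>K\<^esub>) \<one>\<^bsub>G\<^esub> \<otimes> x" by (simp add: l_minus)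
    then show ?thesis using img_monomial_mult_img_ring[OF M _ M.one_closed x] by simp
  qed
  show ?thesis by (rule subringI) (use img_ring_carrier one minus mult img_ring_add[OF M.subset] in auto)
qed

lemma img_ring_comm:
  assumes M: "M \<subseteq> carrier G" and comm: "\<And>g h. g \<in> M \<Longrightarrow> h \<in> M \<Longrightarrow> g \<otimes>\<^bsub>G\<^esub> h = h \<otimes>\<^bsub>G\<^esub> g"
    and x: "x \<in> img_ring M" and y: "y \<in> img_ring M"
  shows "x \<otimes> y = y \<otimes> x"
proof -
  have 1: "img_monomial c h \<otimes> y = y \<otimes> img_monomial c h" if c: "c \<in> carrier K" and h: "h \<in> M" for c h
    using M y
  proof (induction rule: img_ring_induct)
    case zero
    then show ?case using c h M by auto
  next
    case (mono d g y)
    have gh: "g \<in> carrier G" "h \<in> carrier G" using mono h M by auto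
    have "img_monomial c h \<otimes> img_monomial d g = img_monomial d g \<otimes> img_monomial c h"
      using c mono gh comm[OF h mono(2)] by (simp add: img_monomial_mult K.m_comm)
    moreover have "y \<in> carrier Q" using mono img_ring_carrier by blast
    ultimately show ?case using mono c gh
      by (simp add: l_distr r_distr)
  qed
  have yQ: "y \<in> carrier Q" using y img_ring_carrier by blast
  show ?thesis using M x
  proof (induction rule: img_ring_induct)
    case zero
    then show ?case using yQ by simp
  next
    case (mono c h x)
    have "x \<in> carrier Q" "h \<in> carrier G" using mono img_ring_carrier M by auto
    then show ?case using mono 1 yQ by (simp add: l_distr r_distr)
  qed
qed

lemma img_ring_conj:
  assumes N: "N \<lhd> G" and t: "t \<in> carrier G" and x: "x \<in> img_ring N"
  shows "img_monomial \<one>\<^bsub>K\<^esub> t \<otimes> x \<otimes> inv (img_monomial \<one>\<^bsub>K\<^esub> t) \<in> img_ring N"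
proof -
  interpret N: normal N G by fact
  show ?thesis using N.subset x
  proof (induction rule: img_ring_induct)
    case zero
    then show ?case using t img_ring_zero[OF N.subset] by (simp add: img_monomial_unit)
  next
    case (mono c h x)
    have xQ: "x \<in> carrier Q" and hG: "h \<in> carrier G" using mono img_ring_carrier by auto
    have "img_monomial \<one>\<^bsub>K\<^esub> t \<otimes> (img_monomial c h \<oplus> x) \<otimes> inv (img_monomial \<one>\<^bsub>K\<^esub> t) =
        img_monomial c (t \<otimes>\<^bsub>G\<^esub> h \<otimes>\<^bsub>G\<^esub> inv\<^bsub>G\<^esub> t) \<oplus> img_monomial \<one>\<^bsub>K\<^esub> t \<otimes> x \<otimes> inv (img_monomial \<one>\<^bsub>K\<^esub> t)"
      using mono xQ hG t by (simp add: l_distr r_distr img_monomial_unit img_monomial_mult)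
    then show ?case
      using img_ring_add[OF N.subset img_monomial_in_img_ring[OF N.subset mono(1) N.inv_op_closed2[OF t mono(2)]] mono(4)] by simp
  qed
qed

lemma frac_sub_eq: "frac_sub K G N Q \<iota> = {a \<otimes> inv b | a b. a \<in> img_ring N \<and> b \<in> img_ring N - {\<zero>}}"
proof -
  have "b \<noteq> \<zero>\<^bsub>KG\<^esub> \<longleftrightarrow> \<iota> b \<noteq> \<zero>" if "b \<in> supported N" for b
    using \<iota>_nonzero[of b] \<iota>_zero that supported_subset by auto
  then show ?thesis unfolding frac_sub_def img_ring_def by blast
qed

end

section \<open>The field of fractions of the group ring\<close>

lemma (in group) coset_rep_in:
  assumes "right_transversal T N G" and "C \<in> rcosets N"
  shows "coset_rep T C \<in> T" and "coset_rep T C \<in> C"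
proof -
  have "\<exists>!t. t \<in> T \<and> t \<in> C" using assms unfolding right_transversal_def by blast
  then have "coset_rep T C \<in> T \<and> coset_rep T C \<in> C" unfolding coset_rep_def by (rule theI')
  then show "coset_rep T C \<in> T" and "coset_rep T C \<in> C" by auto
qed

lemma (in group) coset_rep_eq:
  assumes "right_transversal T N G" and "C \<in> rcosets N" and "t \<in> T" and "t \<in> C"
  shows "coset_rep T C = t"
  using assms coset_rep_in[OF assms(1,2)] unfolding right_transversal_def by blast

lemma (in group) coset_rep_image:
  assumes T: "right_transversal T N G" and N: "subgroup N G"
  shows "coset_rep T ` (rcosets N) = T"
proof
  show "coset_rep T ` (rcosets N) \<subseteq> T" using coset_rep_in(1)[OF T] by blast
  show "T \<subseteq> coset_rep T ` (rcosets N)"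
  proof
    fix t assume t: "t \<in> T"
    then have tG: "t \<in> carrier G" using T unfolding right_transversal_def by blast
    have "N #> t \<in> rcosets N" using rcosetsI[OF subgroup.subset[OF N] tG] .
    moreover from this have "coset_rep T (N #> t) = t"
      using coset_rep_eq[OF T _ t rcos_self[OF tG N]] by blast
    ultimately show "t \<in> coset_rep T ` (rcosets N)" by (metis imageI)
  qed
qed

lemma (in group) rcoset_eq_of_mem:
  assumes N: "subgroup N G" and C: "C \<in> rcosets N" and x: "x \<in> C"
  shows "C = N #> x" and "x \<in> carrier G"
proof -
  show xG: "x \<in> carrier G" using subgroup.rcosets_carrier[OF N is_group C] x by blast
  obtain y where y: "y \<in> carrier G" "C = N #> y" using C unfolding RCOSETS_def by blast
  then show "C = N #> x" using repr_independence[of x N y] x N by simp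
qed

text \<open>
  The assumptions on the abstract situation, verified for \<open>Q\<close>. Conjugation by a representative maps
  fractions over \<open>N\<close> to such fractions by normality. If \<open>f\<close> and \<open>g\<close> act alike on \<open>L\<close>, then they act
  alike on the image of \<open>N\<close>, so \<open>r f\<close> and \<open>r g\<close> differ by an element of the centralizer of \<open>N\<close>, that
  is, of \<open>N\<close>. Every group element is a product of an element of \<open>N\<close> and a representative, so the
  span of the representatives contains the group ring; it is closed under products and inverses,
  hence contains all fractions.
\<close>

lemma conj_crossed_skew_field:
  fixes \<Gamma> :: "('g, 'n) monoid_scheme" and k :: "('k, 'm) ring_scheme"
    and Q :: "('q, 'r) ring_scheme" and N T :: "'g set"
  assumes "group \<Gamma>" and tf: "torsion_free \<Gamma>" and "field k"
    and max: "maximal_normal_abelian_finite_index N \<Gamma>"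
    and T: "right_transversal T N \<Gamma>" and one_T: "\<one>\<^bsub>\<Gamma>\<^esub> \<in> T"
    and ore: "ore_field_of_fractions (group_ring k \<Gamma>) Q \<iota>"
  shows "crossed_skew_field Q (\<Gamma> Mod N) (frac_sub k \<Gamma> N Q \<iota>) (lift_elt k \<iota> T)"
proof -
  have div: "division_ring Q" using ore unfolding ore_field_of_fractions_def by blast
  interpret G: group \<Gamma> by fact
  interpret K: field k by fact
  interpret ring Q using div unfolding division_ring_def by blast
  interpret embedded_group_ring Q \<Gamma> k \<iota>
    by unfold_locales (use div ore in \<open>auto simp: ore_field_of_fractions_def\<close>)
  have normal: "N \<lhd> \<Gamma>" and N: "subgroup N \<Gamma>" and Ncomm: "comm_group (\<Gamma>\<lparr>carrier := N\<rparr>)"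
    and fin: "finite (rcosets\<^bsub>\<Gamma>\<^esub> N)"
    using max unfolding maximal_normal_abelian_finite_index_def abelian_finite_index_subgroup_def
    by blast+
  interpret N: normal N \<Gamma> by fact
  define L where "L = frac_sub k \<Gamma> N Q \<iota>"
  define r where "r = coset_rep T"
  define u where "u = lift_elt k \<iota> T"
  have u_eq: "u f = img_monomial \<one>\<^bsub>k\<^esub> (r f)" for f
    unfolding u_def lift_elt_def img_monomial_def group_ring_elt_eq r_def ..
  have F: "carrier (\<Gamma> Mod N) = rcosets\<^bsub>\<Gamma>\<^esub> N" unfolding FactGroup_def by simp
  have r_in: "r f \<in> f" and r_carrier: "r f \<in> carrier \<Gamma>" and coset_r: "N #>\<^bsub>\<Gamma>\<^esub> r f = f"
    if "f \<in> rcosets\<^bsub>\<Gamma>\<^esub> N" for f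
    using G.coset_rep_in[OF T that] G.rcoset_eq_of_mem[OF N that] unfolding r_def by auto
  have img_ring_comm': "x \<otimes>\<^bsub>Q\<^esub> y = y \<otimes>\<^bsub>Q\<^esub> x" if "x \<in> img_ring N" "y \<in> img_ring N" for x y
    by (rule img_ring_comm[OF N.subset _ that]) (use comm_groupE(4)[OF Ncomm] in auto)
  have L_eq: "L = {a \<otimes>\<^bsub>Q\<^esub> inv\<^bsub>Q\<^esub> b | a b. a \<in> img_ring N \<and> b \<in> img_ring N - {\<zero>\<^bsub>Q\<^esub>}}"
    unfolding L_def by (rule frac_sub_eq)
  have L: "subfield L Q" unfolding L_eq
    by (rule fractions_subfield[OF division one_not_zero img_ring_subring[OF N] img_ring_comm'])
  have one_img: "\<one>\<^bsub>Q\<^esub> \<in> img_ring N - {\<zero>\<^bsub>Q\<^esub>}" using subringE(3)[OF img_ring_subring[OF N]] one_not_zero by blast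
  have img_ring_L: "x \<in> L" if "x \<in> img_ring N" for x
  proof -
    have "x \<in> carrier Q" using that img_ring_carrier by blast
    then have "x = x \<otimes>\<^bsub>Q\<^esub> inv\<^bsub>Q\<^esub> \<one>\<^bsub>Q\<^esub>" by simp
    then show ?thesis unfolding L_eq using that one_img by blast
  qed
  have img_monomial_L: "img_monomial c n \<in> L" if "c \<in> carrier k" "n \<in> N" for c n
    by (rule img_ring_L[OF img_monomial_in_img_ring[OF N.subset that]])
  interpret C: normalized_subfield Q "\<Gamma> Mod N" L u
  proof (intro normalized_subfield.intro normalized_subfield_axioms.intro)
    show "ring Q" by (rule ring_axioms)
    show "group (\<Gamma> Mod N)" by (rule N.factorgroup_is_group)
    show "Units Q = carrier Q - {\<zero>\<^bsub>Q\<^esub>}" by (rule division)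
    show "subfield L Q" by (rule L)
    show "finite (carrier (\<Gamma> Mod N))" using fin F by simp
    show "u \<one>\<^bsub>\<Gamma> Mod N\<^esub> = \<one>\<^bsub>Q\<^esub>"
    proof -
      have "r N = \<one>\<^bsub>\<Gamma>\<^esub>" unfolding r_def
        by (rule G.coset_rep_eq[OF T N.subgroup_in_rcosets[OF G.is_group] one_T N.one_closed])
      then show ?thesis using u_eq[of N] img_monomial_one by simp
    qed
  next
    fix f assume "f \<in> carrier (\<Gamma> Mod N)"
    then have f: "f \<in> rcosets\<^bsub>\<Gamma>\<^esub> N" using F by simp
    have U: "u f \<in> Units Q" unfolding u_eq using img_monomial_unit(1) r_carrier[OF f] by blast
    then show "u f \<in> carrier Q - {\<zero>\<^bsub>Q\<^esub>}" using division by blast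
    fix p assume "p \<in> L"
    then obtain a b where p: "p = a \<otimes>\<^bsub>Q\<^esub> inv\<^bsub>Q\<^esub> b" and a: "a \<in> img_ring N" and b: "b \<in> img_ring N - {\<zero>\<^bsub>Q\<^esub>}"
      unfolding L_eq by blast
    have aQ: "a \<in> carrier Q" and bQ: "b \<in> carrier Q" and bU: "b \<in> Units Q"
      using a b img_ring_carrier division by auto
    define a' where "a' = u f \<otimes>\<^bsub>Q\<^esub> a \<otimes>\<^bsub>Q\<^esub> inv\<^bsub>Q\<^esub> (u f)"
    define b' where "b' = u f \<otimes>\<^bsub>Q\<^esub> b \<otimes>\<^bsub>Q\<^esub> inv\<^bsub>Q\<^esub> (u f)"
    have a': "a' \<in> img_ring N" and b'img: "b' \<in> img_ring N"
      unfolding a'_def b'_def u_eq using img_ring_conj[OF normal r_carrier[OF f]] a b by auto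
    have b'U: "b' \<in> Units Q" unfolding b'_def using U bU by blast
    then have b': "b' \<in> img_ring N - {\<zero>\<^bsub>Q\<^esub>}" using b'img division by blast
    have uc: "u f \<in> carrier Q" using U by blast
    have "(u f \<otimes>\<^bsub>Q\<^esub> p \<otimes>\<^bsub>Q\<^esub> inv\<^bsub>Q\<^esub> (u f)) \<otimes>\<^bsub>Q\<^esub> b' = a'"
    proof -
      have "(u f \<otimes>\<^bsub>Q\<^esub> p \<otimes>\<^bsub>Q\<^esub> inv\<^bsub>Q\<^esub> (u f)) \<otimes>\<^bsub>Q\<^esub> b' =
          u f \<otimes>\<^bsub>Q\<^esub> a \<otimes>\<^bsub>Q\<^esub> (inv\<^bsub>Q\<^esub> b \<otimes>\<^bsub>Q\<^esub> ((inv\<^bsub>Q\<^esub> (u f) \<otimes>\<^bsub>Q\<^esub> u f) \<otimes>\<^bsub>Q\<^esub> (b \<otimes>\<^bsub>Q\<^esub> inv\<^bsub>Q\<^esub> (u f))))"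
        unfolding p b'_def using U uc aQ bQ bU by (simp add: m_assoc del: Units_l_inv)
      also have "\<dots> = u f \<otimes>\<^bsub>Q\<^esub> a \<otimes>\<^bsub>Q\<^esub> ((inv\<^bsub>Q\<^esub> b \<otimes>\<^bsub>Q\<^esub> b) \<otimes>\<^bsub>Q\<^esub> inv\<^bsub>Q\<^esub> (u f))"
        using U uc aQ bQ bU by (simp add: m_assoc[symmetric])
      also have "\<dots> = a'" unfolding a'_def using U uc aQ bU by simp
      finally show ?thesis .
    qed
    moreover have "u f \<otimes>\<^bsub>Q\<^esub> p \<otimes>\<^bsub>Q\<^esub> inv\<^bsub>Q\<^esub> (u f) \<in> carrier Q" unfolding p using U uc aQ bU by simp
    ultimately have "u f \<otimes>\<^bsub>Q\<^esub> p \<otimes>\<^bsub>Q\<^esub> inv\<^bsub>Q\<^esub> (u f) = a' \<otimes>\<^bsub>Q\<^esub> inv\<^bsub>Q\<^esub> b'"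
      using b'U Units_closed[OF b'U] by (metis Units_inv_closed Units_r_inv m_assoc r_one)
    then show "u f \<otimes>\<^bsub>Q\<^esub> p \<otimes>\<^bsub>Q\<^esub> inv\<^bsub>Q\<^esub> (u f) \<in> L" unfolding L_eq using a' b' by blast
  next
    fix f g assume "f \<in> carrier (\<Gamma> Mod N)" "g \<in> carrier (\<Gamma> Mod N)"
    then have f: "f \<in> rcosets\<^bsub>\<Gamma>\<^esub> N" and g: "g \<in> rcosets\<^bsub>\<Gamma>\<^esub> N" using F by auto
    have fg: "f <#>\<^bsub>\<Gamma>\<^esub> g \<in> rcosets\<^bsub>\<Gamma>\<^esub> N" by (rule N.setmult_closed[OF f g])
    have "r f \<otimes>\<^bsub>\<Gamma>\<^esub> r g \<in> f <#>\<^bsub>\<Gamma>\<^esub> g" using r_in[OF f] r_in[OF g] unfolding set_mult_def by blast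
    then have "r f \<otimes>\<^bsub>\<Gamma>\<^esub> r g \<otimes>\<^bsub>\<Gamma>\<^esub> inv\<^bsub>\<Gamma>\<^esub> r (f <#>\<^bsub>\<Gamma>\<^esub> g) \<in> N"
      using G.diff_neutralizes[OF N fg] r_in[OF fg] by blast
    then show "u f \<otimes>\<^bsub>Q\<^esub> u g \<otimes>\<^bsub>Q\<^esub> inv\<^bsub>Q\<^esub> (u (f \<otimes>\<^bsub>\<Gamma> Mod N\<^esub> g)) \<in> L"
      using img_monomial_L[of "\<one>\<^bsub>k\<^esub>"] r_carrier[OF f] r_carrier[OF g] r_carrier[OF fg]
      by (simp add: u_eq img_monomial_unit img_monomial_mult)
    assume same: "\<And>p. p \<in> L \<Longrightarrow> u f \<otimes>\<^bsub>Q\<^esub> p \<otimes>\<^bsub>Q\<^esub> inv\<^bsub>Q\<^esub> (u f) = u g \<otimes>\<^bsub>Q\<^esub> p \<otimes>\<^bsub>Q\<^esub> inv\<^bsub>Q\<^esub> (u g)"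
    note rf = r_carrier[OF f] and rg = r_carrier[OF g]
    define c where "c = inv\<^bsub>\<Gamma>\<^esub> r g \<otimes>\<^bsub>\<Gamma>\<^esub> r f"
    have c: "c \<in> carrier \<Gamma>" and rfc: "r f = r g \<otimes>\<^bsub>\<Gamma>\<^esub> c"
      unfolding c_def using rf rg by (simp_all add: G.m_assoc[symmetric])
    have "c \<otimes>\<^bsub>\<Gamma>\<^esub> n = n \<otimes>\<^bsub>\<Gamma>\<^esub> c" if n: "n \<in> N" for n
    proof -
      have nG: "n \<in> carrier \<Gamma>" using n N.subset by blast
      have "img_monomial \<one>\<^bsub>k\<^esub> (r f \<otimes>\<^bsub>\<Gamma>\<^esub> n \<otimes>\<^bsub>\<Gamma>\<^esub> inv\<^bsub>\<Gamma>\<^esub> r f) = img_monomial \<one>\<^bsub>k\<^esub> (r g \<otimes>\<^bsub>\<Gamma>\<^esub> n \<otimes>\<^bsub>\<Gamma>\<^esub> inv\<^bsub>\<Gamma>\<^esub> r g)"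
        using same[OF img_monomial_L[OF K.one_closed n]] rf rg nG by (simp add: u_eq img_monomial_unit img_monomial_mult)
      then have eq: "r f \<otimes>\<^bsub>\<Gamma>\<^esub> n \<otimes>\<^bsub>\<Gamma>\<^esub> inv\<^bsub>\<Gamma>\<^esub> r f = r g \<otimes>\<^bsub>\<Gamma>\<^esub> n \<otimes>\<^bsub>\<Gamma>\<^esub> inv\<^bsub>\<Gamma>\<^esub> r g"
        using img_monomial_one_inj rf rg nG by simp
      have "r f \<otimes>\<^bsub>\<Gamma>\<^esub> n = (r f \<otimes>\<^bsub>\<Gamma>\<^esub> n \<otimes>\<^bsub>\<Gamma>\<^esub> inv\<^bsub>\<Gamma>\<^esub> r f) \<otimes>\<^bsub>\<Gamma>\<^esub> r f"
        using rf nG by (simp add: G.m_assoc)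
      also have "\<dots> = r g \<otimes>\<^bsub>\<Gamma>\<^esub> (n \<otimes>\<^bsub>\<Gamma>\<^esub> c)"
        unfolding eq c_def using rf rg nG by (simp add: G.m_assoc)
      finally have "r g \<otimes>\<^bsub>\<Gamma>\<^esub> (c \<otimes>\<^bsub>\<Gamma>\<^esub> n) = r g \<otimes>\<^bsub>\<Gamma>\<^esub> (n \<otimes>\<^bsub>\<Gamma>\<^esub> c)"
        unfolding rfc using rg c nG by (simp add: G.m_assoc)
      then show ?thesis using rg c nG by simp
    qed
    then have cN: "c \<in> N" by (rule G.centralizer_of_maximal_normal_abelian[OF tf max c])
    have "r f \<otimes>\<^bsub>\<Gamma>\<^esub> inv\<^bsub>\<Gamma>\<^esub> r g \<in> N"
      using N.inv_op_closed2[OF rg cN] unfolding rfc .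
    then have "r f \<in> N #>\<^bsub>\<Gamma>\<^esub> r g" using N.rcos_module_rev[OF G.is_group rg rf] by blast
    then show "f = g"
      using G.rcoset_eq_of_mem(1)[OF N g, of "r f"] coset_r[OF f] coset_r[OF g] by simp
  qed
  have img_monomial_combs: "img_monomial c g \<in> C.combs" if c: "c \<in> carrier k" and g: "g \<in> carrier \<Gamma>" for c g
  proof -
    define f where "f = N #>\<^bsub>\<Gamma>\<^esub> g"
    have f: "f \<in> rcosets\<^bsub>\<Gamma>\<^esub> N" unfolding f_def by (rule G.rcosetsI[OF N.subset g])
    define n where "n = g \<otimes>\<^bsub>\<Gamma>\<^esub> inv\<^bsub>\<Gamma>\<^esub> r f"
    have n: "n \<in> N" unfolding n_def
      using G.diff_neutralizes[OF N f _ r_in[OF f]] G.rcos_self[OF g N] unfolding f_def by blast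
    have "img_monomial c n \<otimes>\<^bsub>Q\<^esub> u f = img_monomial c g"
      using c g n r_carrier[OF f] by (simp add: u_eq img_monomial_mult n_def G.m_assoc)
    then show ?thesis using C.term_in_combs[of f "img_monomial c n"] f F img_monomial_L[OF c n] by simp
  qed
  have img_ring_combs: "x \<in> C.combs" if x: "x \<in> img_ring (carrier \<Gamma>)" for x
    using subset_refl x
  proof (induction rule: img_ring_induct)
    case zero
    then show ?case using add.subgroupE(2) subgroup.one_closed[OF C.combs_add_subgroup] by simp
  next
    case (mono c h x)
    then show ?case using add.subgroupE(4)[OF C.combs_add_subgroup] img_monomial_combs by simp
  qed
  have "C.combs = carrier Q"
  proof
    show "C.combs \<subseteq> carrier Q" by (rule C.combs_carrier)
    show "carrier Q \<subseteq> C.combs"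
    proof
      fix x assume "x \<in> carrier Q"
      then obtain a b where a: "a \<in> carrier KG" and b: "b \<in> carrier KG" "b \<noteq> \<zero>\<^bsub>KG\<^esub>"
        and x: "x = \<iota> a \<otimes>\<^bsub>Q\<^esub> inv\<^bsub>Q\<^esub> (\<iota> b)"
        using ore unfolding ore_field_of_fractions_def by blast
      have "\<iota> a \<in> C.combs" "\<iota> b \<in> C.combs"
        using a b img_ring_combs supported_carrier unfolding img_ring_def by auto
      then show "x \<in> C.combs"
        unfolding x using C.combs_mult_closed C.combs_inv_closed \<iota>_nonzero[OF b] by blast
    qed
  qed
  then have "crossed_skew_field Q (\<Gamma> Mod N) L u"
    by unfold_locales
  then show ?thesis unfolding L_def u_def .
qed

theorem proposition3p4:
  fixes \<Gamma> :: "('g, 'n) monoid_scheme"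
    and k :: "('k, 'm) ring_scheme"
    and Q :: "('q, 'r) ring_scheme"
    and \<iota> :: "('g \<Rightarrow> 'k) \<Rightarrow> 'q"
    and N T :: "'g set"
  defines "F \<equiv> \<Gamma> Mod N"
    and "L \<equiv> frac_sub k \<Gamma> N Q \<iota>"
    and "Z \<equiv> ring_center Q"
    and "H \<equiv> conj_group k \<Gamma> N T Q \<iota>"
  assumes "group \<Gamma>" and "finitely_generated_group \<Gamma>"
    and "torsion_free \<Gamma>" and "virtually_abelian \<Gamma>"
    and "field k"
    and "maximal_normal_abelian_finite_index N \<Gamma>"
    and "right_transversal T N \<Gamma>" and "\<one>\<^bsub>\<Gamma>\<^esub> \<in> T"
    and "ore_field_of_fractions (group_ring k \<Gamma>) Q \<iota>"
  shows "(artinian_ring Q \<and>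
          (\<exists>\<sigma> \<tau>. crossed_product Q L F (lift_elt k \<iota> T) \<sigma> \<tau>) \<and>
          left_basis Q L ((\<lambda>t. \<iota> (group_ring_elt k t)) ` T) \<and>
          ring.dimension Q (card (carrier F)) L (carrier Q)) \<and>
         (Z = fixed_subfield L H \<and>
          ring.finite_dimension Q Z (carrier Q) \<and>
          ring.dimension Q ((card (carrier F))\<^sup>2) Z (carrier Q))"
proof -
  have N: "subgroup N \<Gamma>"
    using assms(10)
    unfolding maximal_normal_abelian_finite_index_def abelian_finite_index_subgroup_def by blast
  have div: "division_ring Q" using assms(13) unfolding ore_field_of_fractions_def by blast
  define u where "u = lift_elt k \<iota> T"
  interpret crossed_skew_field Q F L u
    unfolding F_def L_def u_def by (rule conj_crossed_skew_field) fact+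
  have artin: "artinian_ring Q" by (rule division_ring_artinian[OF div])
  have basis: "left_basis Q L ((\<lambda>t. \<iota> (group_ring_elt k t)) ` T)"
  proof -
    obtain fs where fs: "distinct fs" "set fs = carrier F" by (rule enumeration_exists)
    have T: "T = coset_rep T ` carrier F"
      using group.coset_rep_image[OF assms(5,11) N] unfolding F_def FactGroup_def by simp
    have "(\<lambda>t. \<iota> (group_ring_elt k t)) ` T = u ` carrier F"
      unfolding u_def lift_elt_def by (subst T) (simp add: image_image)
    then have "set (map u fs) = (\<lambda>t. \<iota> (group_ring_elt k t)) ` T" using fs(2) by simp
    then show ?thesis unfolding left_basis_def
      using independent_u[OF fs] Span_u[OF fs] spanning by blast
  qed
  have H: "H = (\<lambda>f. conj_on Q L (u f)) ` carrier F"
    unfolding H_def conj_group_def L_def u_def F_def ..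
  have "conj_on Q L (u f) p = act f p" if "p \<in> L" for f p
    using that unfolding conj_on_def act_def by simp
  then have "fixed_subfield L H = fixed" unfolding fixed_subfield_def H by auto
  then have center: "Z = fixed_subfield L H" unfolding Z_def center_eq_fixed by simp
  show ?thesis
    using artin crossed_product basis dimension_over_L center dimension_over_center
      finite_dimensionI[OF dimension_over_center]
    unfolding u_def Z_def by blast
qed

end
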